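(* Let $\alpha\ge0$, $\mu>0$, $\beta\in(0,1]$, and let $g:\mathbb R\times\mathbb R\to\mathbb R$ be a kernel with $g(\cdot,x)\in L_2(\mathbb R)$ for all $x$. Consider the Gaussian random fields $$U_0^{g}(t,x)=\sqrt{C_1}\int_{\mathbb R}\widehat g(\lambda,x)E_\beta(-\mu t^\beta|\lambda|^\alpha)W(d\lambda),\qquad \tilde U_0^{g}(t,x)=\sqrt{C_2}\int_{\mathbb R}\widehat g(\lambda,x)E_\beta(-\mu t^\beta|\lambda|^\alpha)|\lambda|^{\frac{\kappa_0-1}2}W(d\lambda),$$ $t>0$, $x\in\mathbb R$, with constants $C_1=C(\bar\kappa,\bar w,\bar A)$, $C_2=C(\kappa_0,A_0)$ as in the context. Let $$\eta_*=\sup\Bigl\{\eta\in(0,1]:\int_{\mathbb R}|\lambda|^{2\alpha\eta}|\widehat g(\lambda,x)|^2d\lambda<\infty\text{ for all }x\in\mathbb R\Bigr\},\quad \tilde\eta_*=\sup\Bigl\{\eta\in(0,1]:\int_{\mathbb R}|\lambda|^{2\alpha\eta+\kappa_0-1}|\widehat g(\lambda,x)|^2d\lambda<\infty\text{ for all }x\in\mathbb R\Bigr\}.$$ (i) If $\eta_*>0$ exists for $g$ (i.e. the first set is nonempty), then $U_0^g(t,x)$ is mean-square Hölder continuous in $t$ of any order $\gamma_t\in(0,\eta_*\beta)$, and it has a continuous modification whose sample paths are almost surely Hölder continuous in $t$ of order $\gamma_t$. (ii) If $\tilde\eta_*>0$ exists for $g$ (i.e. the second set is nonempty), then $\tilde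 U_0^g(t,x)$ is mean-square Hölder continuous in $t$ and has a continuous modification whose sample paths are almost surely Hölder continuous in $t$ of any order $\gamma_t\in(0,\tilde\eta_*\beta)$.
   Context: $E_\beta(s)=\sum_{k\ge0}s^k/\Gamma(1+\beta k)$ is the Mittag-Leffler function ($E_1(s)=e^s$); $K_\nu$ is the modified Bessel function of the second kind. $W$ is a Gaussian white-noise random measure on $\mathbb R$ with $\mathbb E|W(d\lambda)|^2=d\lambda$, symmetric so that the fields are real-valued. $\widehat g(\lambda,x):=\int_{\mathbb R}e^{-i\lambda x_1}g(x_1,x)dx_1$. Parameters: $A_0,\dots,A_n\ge0$ with $\sum A_j=1$, $\kappa_0,\dots,\kappa_n\in(0,1)$, $w_1,\dots,w_n>0$; $c_1(\kappa_j):=2^{\mathbf 1_{\{0\}}(j)}2^{(1-\kappa_j)/2}/(\sqrt\pi\,\Gamma(\kappa_j/2))$; $C(\bar\kappa,\bar w,\bar A):=\sum_{j=1}^nc_1(\kappa_j)A_jK_{\frac{\kappa_j-1}2}(w_j)w_j^{\frac{\kappa_j-1}2}$; $C(\kappa_0,A_0):=A_0/(\Gamma(\kappa_0)\cos(\kappa_0\pi/2))$. These fields are the multiscaling limits of kernel-smoothed solutions of the fractional Riesz–Bessel equation $\partial^\beta_t u=-\mu(I-\Delta)^{\gamma/2}(-\Delta)^{\alpha/2}u$ with long-memory Gaussian initial data (case $A_0=0$ for $U_0^g$, $A_0\ne0$ for $\tilde U_0^g$). *)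

theory Defs
  imports "HOL-Probability.Probability"
begin

definition mittag_leffler :: "real \<Rightarrow> real \<Rightarrow> real" where
  "mittag_leffler \<beta> s = (\<Sum>k. s ^ k / Gamma (1 + \<beta> * real k))"

text \<open>Modified Bessel function of the second kind, via its standard integral
  representation K_nu(w) = int_0^infty exp(-w cosh t) cosh(nu t) dt (w > 0).\<close>
definition besselK :: "real \<Rightarrow> real \<Rightarrow> real" where
  "besselK \<nu> w = (LINT t:{0..}|lborel. exp (- w * cosh t) * cosh (\<nu> * t))"

definition c1 :: "nat \<Rightarrow> real \<Rightarrow> real" where
  "c1 j \<kappa> = 2 ^ (if j = 0 then 1 else 0) * 2 powr ((1 - \<kappa>) / 2) / (sqrt pi * Gamma (\<kappa> / 2))"

definition C_bar :: "nat \<Rightarrow> (nat \<Rightarrow> real) \<Rightarrow> (nat \<Rightarrow> real) \<Rightarrow> (nat \<Rightarrow> real) \<Rightarrow> real" where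
  "C_bar n \<kappa> w A = (\<Sum>j=1..n. c1 j (\<kappa> j) * A j * besselK ((\<kappa> j - 1) / 2) (w j)
                                  * w j powr ((\<kappa> j - 1) / 2))"

definition C_zero :: "real \<Rightarrow> real \<Rightarrow> real" where
  "C_zero \<kappa>0 A0 = A0 / (Gamma \<kappa>0 * cos (\<kappa>0 * pi / 2))"

text \<open>Centered Gaussian random variable with variance v (possibly degenerate),
  via its characteristic function.\<close>
definition centered_gaussian :: "'a measure \<Rightarrow> ('a \<Rightarrow> real) \<Rightarrow> real \<Rightarrow> bool" where
  "centered_gaussian M X v \<longleftrightarrow> X \<in> borel_measurable M \<and>
     (\<forall>\<theta>. char (distr M borel X) \<theta> = complex_of_real (exp (- v * \<theta>\<^sup>2 / 2)))"

text \<open>Square-integrable Hermitian-symmetric functions: the admissible integrands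
  for a real-valued (symmetric) Gaussian white noise on R.\<close>
definition hermitian_L2 :: "(real \<Rightarrow> complex) \<Rightarrow> bool" where
  "hermitian_L2 f \<longleftrightarrow> f \<in> borel_measurable lborel \<and>
     (\<integral>\<^sup>+ l. ennreal ((cmod (f l))\<^sup>2) \<partial>lborel) < \<infinity> \<and>
     (AE l in lborel. f (- l) = cnj (f l))"

text \<open>I f = int f(lambda) W(d lambda): stochastic integral w.r.t. a symmetric Gaussian
  white noise W with E|W(d lambda)|^2 = d lambda. Characterised by: all finite real linear
  combinations of the I f are centered Gaussian with variance int |sum c_i f_i|^2.\<close>
definition real_white_noise_integral ::
  "'a measure \<Rightarrow> ((real \<Rightarrow> complex) \<Rightarrow> 'a \<Rightarrow> real) \<Rightarrow> bool" where
  "real_white_noise_integral M I \<longleftrightarrow> prob_space M \<and>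
     (\<forall>(fs :: (real \<Rightarrow> complex) list) (cs :: real list).
        length cs = length fs \<longrightarrow> (\<forall>f\<in>set fs. hermitian_L2 f) \<longrightarrow>
        centered_gaussian M (\<lambda>\<omega>. \<Sum>i<length fs. cs ! i * I (fs ! i) \<omega>)
          (LINT l|lborel. (cmod (\<Sum>i<length fs. complex_of_real (cs ! i) * (fs ! i) l))\<^sup>2))"

definition l2_fourier_transform :: "(real \<Rightarrow> real) \<Rightarrow> (real \<Rightarrow> complex) \<Rightarrow> bool" where
  "l2_fourier_transform f F \<longleftrightarrow> F \<in> borel_measurable lborel \<and>
     ((\<lambda>n::nat. \<integral>\<^sup>+ l. ennreal ((cmod (F l -
          set_lebesgue_integral lborel {- real n..real n}
             (\<lambda>y. cis (- l * y) * complex_of_real (f y))))\<^sup>2) \<partial>lborel) \<longlonglongrightarrow> 0)"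

definition U0 :: "((real \<Rightarrow> complex) \<Rightarrow> 'a \<Rightarrow> real) \<Rightarrow> real \<Rightarrow> real \<Rightarrow> real \<Rightarrow> real
                   \<Rightarrow> (real \<Rightarrow> real \<Rightarrow> complex) \<Rightarrow> real \<Rightarrow> real \<Rightarrow> 'a \<Rightarrow> real" where
  "U0 I C \<alpha> \<beta> \<mu> ghat t x \<omega> = sqrt C *
     I (\<lambda>l. ghat l x * complex_of_real (mittag_leffler \<beta> (- \<mu> * t powr \<beta> * \<bar>l\<bar> powr \<alpha>))) \<omega>"

definition U0_tilde :: "((real \<Rightarrow> complex) \<Rightarrow> 'a \<Rightarrow> real) \<Rightarrow> real \<Rightarrow> real \<Rightarrow> real \<Rightarrow> real \<Rightarrow> real
                   \<Rightarrow> (real \<Rightarrow> real \<Rightarrow> complex) \<Rightarrow> real \<Rightarrow> real \<Rightarrow> 'a \<Rightarrow> real" where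
  "U0_tilde I C \<kappa>0 \<alpha> \<beta> \<mu> ghat t x \<omega> = sqrt C *
     I (\<lambda>l. ghat l x * complex_of_real (mittag_leffler \<beta> (- \<mu> * t powr \<beta> * \<bar>l\<bar> powr \<alpha>)
              * \<bar>l\<bar> powr ((\<kappa>0 - 1) / 2))) \<omega>"

definition eta_set :: "real \<Rightarrow> real \<Rightarrow> (real \<Rightarrow> real \<Rightarrow> complex) \<Rightarrow> real set" where
  "eta_set \<alpha> e ghat = {\<eta>. 0 < \<eta> \<and> \<eta> \<le> 1 \<and>
     (\<forall>x. (\<integral>\<^sup>+ l. ennreal (\<bar>l\<bar> powr (2 * \<alpha> * \<eta> + e) * (cmod (ghat l x))\<^sup>2) \<partial>lborel) < \<infinity>)}"

definition ms_holder :: "'a measure \<Rightarrow> (real \<Rightarrow> 'a \<Rightarrow> real) \<Rightarrow> real \<Rightarrow> bool" where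
  "ms_holder M X \<gamma> \<longleftrightarrow> (\<exists>C. \<forall>t s. 0 < t \<longrightarrow> 0 < s \<longrightarrow>
     (\<integral>\<^sup>+ \<omega>. ennreal ((X t \<omega> - X s \<omega>)\<^sup>2) \<partial>M) \<le> ennreal (C * \<bar>t - s\<bar> powr (2 * \<gamma>)))"

definition holder_on :: "real set \<Rightarrow> (real \<Rightarrow> real) \<Rightarrow> real \<Rightarrow> bool" where
  "holder_on S f \<gamma> \<longleftrightarrow> (\<exists>C. \<forall>t\<in>S. \<forall>s\<in>S. \<bar>f t - f s\<bar> \<le> C * \<bar>t - s\<bar> powr \<gamma>)"

definition holder_modification :: "'a measure \<Rightarrow> (real \<Rightarrow> 'a \<Rightarrow> real) \<Rightarrow> real \<Rightarrow> bool" where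
  "holder_modification M X \<gamma> \<longleftrightarrow> (\<exists>Y :: real \<Rightarrow> 'a \<Rightarrow> real.
     (\<forall>t>0. Y t \<in> borel_measurable M \<and> (AE \<omega> in M. Y t \<omega> = X t \<omega>)) \<and>
     (AE \<omega> in M. continuous_on {0<..} (\<lambda>t. Y t \<omega>) \<and>
        (\<forall>a b. 0 < a \<longrightarrow> holder_on {a..b} (\<lambda>t. Y t \<omega>) \<gamma>)))"

end

theory Submission
  imports Defs
begin

text \<open>On the negative half-line \<open>E\<^bsub>\<beta>\<^esub>\<close> takes values in \<open>[0, 1]\<close> and is Lipschitz, hence
  \<open>\<theta>\<close>-Hoelder for every \<open>\<theta> \<in> (0, 1]\<close>. Since \<open>\<bar>t\<^sup>\<beta> - s\<^sup>\<beta>\<bar> \<le> \<bar>t - s\<bar>\<^sup>\<beta>\<close>, the spectral density of an increment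
  of the field is dominated by \<open>\<bar>t - s\<bar>\<^sup>2\<^sup>\<theta>\<^sup>\<beta> \<bar>\<lambda>\<bar>\<^sup>2\<^sup>\<alpha>\<^sup>\<theta>\<close> times the given one, which is integrable for \<open>\<theta> \<le> \<eta>\<close>.
  This is the mean-square bound; the moments of Gaussian increments are powers of their variance, so the
  Kolmogorov-Chentsov criterion applied to a sufficiently high moment gives the sample paths.

  The properties of \<open>E\<^bsub>\<beta>\<^esub>\<close> come from a Volterra equation for \<open>r s = s\<^sup>\<beta>\<^sup>-\<^sup>1 E\<^bsub>\<beta>,\<beta>\<^esub> (- s\<^sup>\<beta>)\<close>, the negated
  derivative of \<open>E\<^bsub>\<beta>\<^esub> (- s\<^sup>\<beta>)\<close>: a first zero of \<open>r\<close> contradicts the log-convexity of the kernel \<open>s\<^sup>\<beta>\<^sup>-\<^sup>1\<close>.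
  That the Fourier transforms are admissible integrands rests on the inequality half of Plancherel's
  theorem, obtained by Gaussian regularisation.\<close>

section \<open>The Mittag-Leffler function on the negative half-line\<close>

text \<open>Discard \<open>{0..T}\<close> from the Gamma integral and bound \<open>t powr s\<close>
  below by \<open>T powr s\<close> on the rest. The free parameter \<open>T\<close> makes this a
  cheap substitute for Stirling: \<open>1 / Gamma (1 + \<beta> * k)\<close> decays faster than any
  geometric sequence.\<close>

lemma Gamma_ge_powr:
  fixes s T :: real
  assumes "0 \<le> s" "0 < T"
  shows "T powr s * exp (- T) \<le> Gamma (1 + s)"
proof -
  have 1: "((\<lambda>t. t powr s / exp t) has_integral Gamma (1 + s)) {0..}"
    using Gamma_integral_real[of "1 + s"] assms by simp
  have 2: "((\<lambda>t. T powr s * exp (- t)) has_integral T powr s * exp (- T)) {T..}"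
    using has_integral_mult_right[OF has_integral_exp_minus_to_infinity[of 1 T], of "T powr s"] by simp
  have 3: "((\<lambda>t. if t \<in> {T..} then T powr s * exp (- t) else 0) has_integral T powr s * exp (- T)) {0..}"
    using 2 assms by (subst has_integral_restrict) auto
  show ?thesis
    by (rule has_integral_le[OF 3 1]) (use assms in \<open>auto simp: exp_minus field_simps intro!: powr_mono2\<close>)
qed

lemma summable_mittag_leffler:
  fixes \<beta> s :: real
  assumes "0 < \<beta>"
  shows "summable (\<lambda>k. inverse (Gamma (1 + \<beta> * real k)) * s ^ k)"
proof -
  \<comment> \<open>Then \<open>T powr \<beta> = 2 * |s| + 1\<close>, so the k-th term is at most
    \<open>exp T\<close> times the k-th power of \<open>|s| / (2 * |s| + 1) < 1 / 2\<close>; the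
    \<open>+ 1\<close> keeps the base positive at \<open>s = 0\<close>.\<close>
  define T where "T = (2 * \<bar>s\<bar> + 1) powr (1 / \<beta>)"
  have T: "T > 0" "T powr \<beta> = 2 * \<bar>s\<bar> + 1"
    using assms by (auto simp: T_def powr_powr)
  show ?thesis
  proof (rule summable_comparison_test)
    show "summable (\<lambda>k. exp T * (\<bar>s\<bar> / (2 * \<bar>s\<bar> + 1)) ^ k)"
      by (intro summable_mult summable_geometric) auto
    show "\<exists>N. \<forall>k\<ge>N. norm (inverse (Gamma (1 + \<beta> * real k)) * s ^ k) \<le> exp T * (\<bar>s\<bar> / (2 * \<bar>s\<bar> + 1)) ^ k"
    proof (intro exI allI impI)
      fix k :: nat
      have pos: "Gamma (1 + \<beta> * real k) > 0" using assms by (intro Gamma_real_pos) (simp add: add_pos_nonneg)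
      have "(2 * \<bar>s\<bar> + 1) ^ k = T powr (\<beta> * real k)"
        using T by (simp add: powr_powr [symmetric] powr_realpow)
      then have "(2 * \<bar>s\<bar> + 1) ^ k * exp (- T) \<le> Gamma (1 + \<beta> * real k)"
        using Gamma_ge_powr[of "\<beta> * real k" T] T assms by simp
      then have "inverse (Gamma (1 + \<beta> * real k)) \<le> exp T / (2 * \<bar>s\<bar> + 1) ^ k"
        using pos by (simp add: field_simps exp_minus)
      from mult_right_mono[OF this, of "\<bar>s\<bar> ^ k"] pos
      show "norm (inverse (Gamma (1 + \<beta> * real k)) * s ^ k) \<le> exp T * (\<bar>s\<bar> / (2 * \<bar>s\<bar> + 1)) ^ k"
        by (simp add: abs_mult power_abs power_divide)
    qed
  qed
qed

text \<open>\<open>E\<^bsub>\<beta>,\<beta>\<^esub>\<close>, which is \<open>\<beta>\<close> times the derivative of \<open>E\<^bsub>\<beta>\<^esub>\<close>.\<close>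
definition mittag_leffler2 :: "real \<Rightarrow> real \<Rightarrow> real" where
  "mittag_leffler2 \<beta> s = (\<Sum>k. inverse (Gamma (\<beta> * real (Suc k))) * s ^ k)"

text \<open>The factor \<open>k + 1\<close> produced by differentiation is absorbed by
  \<open>Gamma (1 + z) = z * Gamma z\<close> at \<open>z = \<beta> * (k + 1)\<close>, which leaves
  only \<open>1 / \<beta>\<close>.\<close>

lemma diffs_mittag_leffler:
  fixes \<beta> :: real
  assumes "0 < \<beta>"
  shows "diffs (\<lambda>k. inverse (Gamma (1 + \<beta> * real k))) =
    (\<lambda>k. inverse \<beta> * inverse (Gamma (\<beta> * real (Suc k))))"
proof
  fix k
  have "\<beta> * real (Suc k) \<notin> \<int>\<^sub>\<le>\<^sub>0"
    using assms by (metis mult_pos_pos nonpos_Ints_nonpos not_le of_nat_0_less_iff zero_less_Suc)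
  then have "Gamma (1 + \<beta> * real (Suc k)) = \<beta> * real (Suc k) * Gamma (\<beta> * real (Suc k))"
    by (metis Gamma_plus1 add.commute)
  then show "diffs (\<lambda>k. inverse (Gamma (1 + \<beta> * real k))) k = inverse \<beta> * inverse (Gamma (\<beta> * real (Suc k)))"
    unfolding diffs_def by (simp del: of_nat_Suc add: field_simps)
qed

lemma summable_mittag_leffler2:
  fixes \<beta> s :: real
  assumes "0 < \<beta>"
  shows "summable (\<lambda>k. inverse (Gamma (\<beta> * real (Suc k))) * s ^ k)"
proof -
  have "summable (\<lambda>k. inverse \<beta> * (inverse (Gamma (\<beta> * real (Suc k))) * s ^ k))"
    using termdiff_converges_all[OF summable_mittag_leffler[OF assms], of s]
    unfolding diffs_mittag_leffler[OF assms] by (simp add: mult.assoc)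
  then show ?thesis using assms by (subst (asm) summable_cmult_iff) auto
qed

lemma DERIV_mittag_leffler:
  assumes "0 < \<beta>"
  shows "(mittag_leffler \<beta> has_field_derivative inverse \<beta> * mittag_leffler2 \<beta> s) (at s)"
proof -
  have "mittag_leffler \<beta> = (\<lambda>s. \<Sum>k. inverse (Gamma (1 + \<beta> * real k)) * s ^ k)"
    by (simp add: fun_eq_iff mittag_leffler_def divide_inverse mult.commute)
  moreover have "(\<Sum>k. diffs (\<lambda>k. inverse (Gamma (1 + \<beta> * real k))) k * s ^ k) = inverse \<beta> * mittag_leffler2 \<beta> s"
    unfolding diffs_mittag_leffler[OF assms] mittag_leffler2_def
    using suminf_mult[OF summable_mittag_leffler2[OF assms, of s], of "inverse \<beta>"] by (simp add: mult.assoc)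
  ultimately show ?thesis
    using termdiffs_strong_converges_everywhere[OF summable_mittag_leffler[OF assms], of s] by simp
qed

lemma isCont_mittag_leffler2:
  assumes "0 < \<beta>"
  shows "isCont (mittag_leffler2 \<beta>) s"
  using isCont_powser_converges_everywhere[OF summable_mittag_leffler2[OF assms], of s]
  unfolding mittag_leffler2_def[abs_def] .

lemma mittag_leffler_0: "mittag_leffler \<beta> 0 = 1"
  using powser_zero[of "\<lambda>k. inverse (Gamma (1 + \<beta> * real k))"]
  by (simp add: mittag_leffler_def divide_inverse mult.commute)

lemma mittag_leffler2_0: "mittag_leffler2 \<beta> 0 = inverse (Gamma \<beta>)"
  unfolding mittag_leffler2_def by (subst powser_zero) simp

section \<open>The Volterra equation\<close>

text \<open>Substitution \<open>s = t * u\<close> in Euler's Beta integral. It evaluates the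
  convolution of the kernel with each power of \<open>s\<close> in the series of \<open>r\<close>
  below.\<close>

lemma has_integral_Beta_scaled:
  fixes a b t :: real
  assumes "0 < a" "0 < b" "0 < t"
  shows "((\<lambda>s. (t - s) powr (a - 1) * s powr (b - 1)) has_integral
    t powr (a + b - 1) * Beta a b) {0..t}"
proof -
  have "((\<lambda>u. u powr (b - 1) * (1 - u) powr (a - 1)) has_integral Beta b a) (cbox 0 1)"
    using has_integral_Beta_real[of b a] assms by simp
  from has_integral_affinity'[OF this, of "1 / t" 0] assms
  have "((\<lambda>s. (s / t) powr (b - 1) * (1 - s / t) powr (a - 1)) has_integral Beta b a * t) {0..t}"
    by (simp add: field_simps)
  from has_integral_mult_right[OF this, of "t powr (a + b - 2)"]
  have "((\<lambda>s. t powr (a + b - 2) * ((s / t) powr (b - 1) * (1 - s / t) powr (a - 1))) has_integral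
     t powr (a + b - 1) * Beta a b) {0..t}"
    using powr_add[of t "a + b - 2" 1] assms by (simp add: Beta_commute mult_ac)
  then show ?thesis
  proof (rule has_integral_eq[rotated])
    fix s assume s: "s \<in> {0..t}"
    have "1 - s / t = (t - s) / t" using assms by (simp add: field_simps)
    moreover have "t powr (a + b - 2) = t powr (b - 1) * t powr (a - 1)"
      by (simp flip: powr_add) (simp add: algebra_simps)
    ultimately show "t powr (a + b - 2) * ((s / t) powr (b - 1) * (1 - s / t) powr (a - 1)) =
        (t - s) powr (a - 1) * s powr (b - 1)"
      using s assms by (simp add: powr_divide)
  qed
qed

text \<open>Convolution with the kernel sends the k-th term of \<open>r\<close> to
  \<open>- Gamma \<beta>\<close> times the next term at \<open>t\<close>, because the Beta factor
  trades one coefficient for its successor. The sum is therefore \<open>- Gamma \<beta>\<close>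
  times the series of \<open>r t\<close> stripped of its leading term
  \<open>t powr (\<beta> - 1) / Gamma \<beta>\<close>.\<close>

lemma mittag_leffler2_Volterra:
  fixes \<beta> t :: real
  assumes \<beta>: "0 < \<beta>" and t: "0 < t"
  defines "r \<equiv> \<lambda>s. s powr (\<beta> - 1) * mittag_leffler2 \<beta> (- (s powr \<beta>))"
  shows "((\<lambda>s. (t - s) powr (\<beta> - 1) * r s) has_integral
    t powr (\<beta> - 1) - Gamma \<beta> * r t) {0..t}"
proof -
  define c where "c k = inverse (Gamma (\<beta> * real (Suc k)))" for k
  have c_pos: "c k > 0" for k using \<beta> by (auto simp: c_def intro!: Gamma_real_pos)
  have sm: "summable (\<lambda>k. c k * s ^ k)" for s
    using summable_mittag_leffler2[OF \<beta>] by (simp add: c_def)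
  define f where "f k s = (t - s) powr (\<beta> - 1) * (s powr (\<beta> - 1) * (c k * (- (s powr \<beta>)) ^ k))" for k s
  define F where "F n s = (\<Sum>k<n. f k s)" for n s
  have If: "(f k has_integral Gamma \<beta> * t powr (\<beta> - 1) * (- (c (Suc k) * (- (t powr \<beta>)) ^ Suc k))) {0..t}" for k
  proof -
    have "f k s = (-1) ^ k * c k * ((t - s) powr (\<beta> - 1) * s powr (\<beta> * real (Suc k) - 1))" if "s \<in> {0..t}" for s
    proof -
      have "(- (s powr \<beta>)) ^ k = (-1) ^ k * (s powr \<beta>) ^ k" by (rule power_minus)
      moreover have "s powr (\<beta> * real (Suc k) - 1) = s powr (\<beta> - 1) * (s powr \<beta>) ^ k"
      \<comment> \<open>At \<open>s = 0\<close> both sides vanish, since \<open>0 powr a = 0\<close>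
        whatever the exponent.\<close>
      proof (cases "s = 0")
        case False
        then have "(s powr \<beta>) ^ k = s powr (\<beta> * real k)" using that
          by (simp add: powr_powr[symmetric] powr_realpow)
        then show ?thesis by (simp flip: powr_add add: algebra_simps)
      qed simp
      ultimately show ?thesis by (simp add: f_def mult_ac)
    qed
    moreover have "((\<lambda>s. (-1) ^ k * c k * ((t - s) powr (\<beta> - 1) * s powr (\<beta> * real (Suc k) - 1))) has_integral
       (-1) ^ k * c k * (t powr (\<beta> + \<beta> * real (Suc k) - 1) * Beta \<beta> (\<beta> * real (Suc k)))) {0..t}"
      by (intro has_integral_mult_right has_integral_Beta_scaled) (use \<beta> t in auto)
    moreover have "(-1) ^ k * c k * (t powr (\<beta> + \<beta> * real (Suc k) - 1) * Beta \<beta> (\<beta> * real (Suc k))) =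
        Gamma \<beta> * t powr (\<beta> - 1) * (- (c (Suc k) * (- (t powr \<beta>)) ^ Suc k))"
    proof -
      have "Beta \<beta> (\<beta> * real (Suc k)) = Gamma \<beta> * inverse (c k) * c (Suc k)"
        by (simp add: Beta_def c_def divide_inverse algebra_simps)
      moreover have "(- (t powr \<beta>)) ^ Suc k = - ((-1) ^ k * t powr (\<beta> * real (Suc k)))"
      proof -
        have "(t powr \<beta>) ^ Suc k = t powr (\<beta> * real (Suc k))"
          using t by (simp add: powr_powr[symmetric] powr_realpow del: of_nat_Suc power_Suc)
        then show ?thesis by (subst power_minus) simp
      qed
      moreover have "t powr (\<beta> + \<beta> * real (Suc k) - 1) = t powr (\<beta> - 1) * t powr (\<beta> * real (Suc k))"
        by (simp flip: powr_add add: algebra_simps)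
      ultimately show ?thesis using c_pos[of k] by (simp only:) simp
    qed
    ultimately show ?thesis by (metis (no_types, lifting) has_integral_cong)
  qed
  have IF: "(F n has_integral (\<Sum>k<n. Gamma \<beta> * t powr (\<beta> - 1) * (- (c (Suc k) * (- (t powr \<beta>)) ^ Suc k)))) {0..t}" for n
    unfolding F_def by (intro has_integral_sum If) auto
  \<comment> \<open>Dominating function: replacing \<open>s\<close> by \<open>t\<close> inside the
    power series and summing absolute values leaves a Beta integral with both parameters equal to
    \<open>\<beta>\<close>.\<close>
  define h where "h s = (t - s) powr (\<beta> - 1) * s powr (\<beta> - 1) * (\<Sum>k. c k * (t powr \<beta>) ^ k)" for s
  have h: "h integrable_on {0..t}"
    unfolding h_def
    by (intro integrable_on_mult_left has_integral_integrable[OF has_integral_Beta_scaled]) (use \<beta> t in auto)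
  have le: "norm (F n s) \<le> h s" if s: "s \<in> {0..t}" for n s
  proof -
    have "norm (F n s) \<le> (\<Sum>k<n. norm (f k s))" unfolding F_def by (rule norm_sum)
    also have "\<dots> \<le> (\<Sum>k<n. (t - s) powr (\<beta> - 1) * s powr (\<beta> - 1) * (c k * (t powr \<beta>) ^ k))"
    proof (rule sum_mono)
      fix k
      have "(s powr \<beta>) ^ k \<le> (t powr \<beta>) ^ k"
        using s \<beta> by (intro power_mono powr_mono2) auto
      then show "norm (f k s) \<le> (t - s) powr (\<beta> - 1) * s powr (\<beta> - 1) * (c k * (t powr \<beta>) ^ k)"
        using c_pos[of k] unfolding f_def
        by (simp add: abs_mult power_abs mult.assoc mult_left_mono)
    qed
    also have "\<dots> = (t - s) powr (\<beta> - 1) * s powr (\<beta> - 1) * (\<Sum>k<n. c k * (t powr \<beta>) ^ k)"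
      by (simp add: sum_distrib_left)
    also have "\<dots> \<le> h s"
      unfolding h_def using c_pos
      by (intro mult_left_mono sum_le_suminf sm) (auto simp: less_imp_le)
    finally show ?thesis .
  qed
  have conv: "(\<lambda>n. F n s) \<longlonglongrightarrow> (t - s) powr (\<beta> - 1) * r s" for s
    using summable_LIMSEQ[OF sm[of "- (s powr \<beta>)"]]
    unfolding F_def f_def r_def mittag_leffler2_def c_def
    by (auto simp: sum_distrib_left[symmetric] intro!: tendsto_mult_left)
  have A: "(\<lambda>s. (t - s) powr (\<beta> - 1) * r s) integrable_on {0..t}"
    and B: "(\<lambda>n. integral {0..t} (F n)) \<longlonglongrightarrow> integral {0..t} (\<lambda>s. (t - s) powr (\<beta> - 1) * r s)"
    using dominated_convergence[OF has_integral_integrable[OF IF] h le conv] by simp_all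
  \<comment> \<open>Only indices from 1 on occur; the missing \<open>c 0 = 1 / Gamma \<beta>\<close>
    becomes the inhomogeneous term \<open>t powr (\<beta> - 1)\<close>.\<close>
  have "(\<lambda>n. \<Sum>k<n. c (Suc k) * (- (t powr \<beta>)) ^ Suc k) \<longlonglongrightarrow> mittag_leffler2 \<beta> (- (t powr \<beta>)) - c 0"
    using summable_LIMSEQ[OF summable_ignore_initial_segment[OF sm[of "- (t powr \<beta>)"], of 1]]
      suminf_split_head[OF sm[of "- (t powr \<beta>)"]] unfolding mittag_leffler2_def c_def by simp
  from tendsto_mult_left[OF this, of "- (Gamma \<beta> * t powr (\<beta> - 1))"]
  have "(\<lambda>n. integral {0..t} (F n)) \<longlonglongrightarrow> - (Gamma \<beta> * t powr (\<beta> - 1)) * (mittag_leffler2 \<beta> (- (t powr \<beta>)) - c 0)"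
    unfolding integral_unique[OF IF] by (simp add: sum_distrib_left sum_negf)
  with B have "integral {0..t} (\<lambda>s. (t - s) powr (\<beta> - 1) * r s) =
      - (Gamma \<beta> * t powr (\<beta> - 1)) * (mittag_leffler2 \<beta> (- (t powr \<beta>)) - c 0)"
    by (rule LIMSEQ_unique)
  also have "\<dots> = t powr (\<beta> - 1) - Gamma \<beta> * r t"
    using Gamma_real_pos[OF \<beta>] by (simp add: c_def r_def algebra_simps)
  finally show ?thesis using A by (simp add: has_integral_integrable_integral)
qed


section \<open>Signs, monotonicity and Hoelder bounds\<close>

text \<open>At a first zero \<open>t0\<close> the convolution must carry at least the mass
  \<open>t0 powr (\<beta> - 1)\<close>. Compared with an earlier time \<open>t\<close>, the part
  over \<open>[0, t]\<close> falls short of this by the normalised value of \<open>r t\<close>. If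
  \<open>t\<close> maximises \<open>r\<close> on a short interval ending at \<open>t0\<close>, the
  part over \<open>[t, t0]\<close> is too small to close the gap.\<close>

lemma mittag_leffler2_pos:
  fixes \<beta> x :: real
  assumes \<beta>: "0 < \<beta>" "\<beta> \<le> 1" and x: "0 \<le> x"
  shows "0 < mittag_leffler2 \<beta> (- x)"
proof (rule ccontr)
  assume "\<not> 0 < mittag_leffler2 \<beta> (- x)"
  \<comment> \<open>Signs are read off \<open>\<phi>\<close>, which is continuous up to 0 with value
    \<open>1 / Gamma \<beta>\<close> there, whereas \<open>r\<close> has the default value 0 at
    0.\<close>
  define \<phi> where "\<phi> s = mittag_leffler2 \<beta> (- (s powr \<beta>))" for s
  define r where "r s = s powr (\<beta> - 1) * \<phi> s" for s
  have G: "Gamma \<beta> > 0" using \<beta> by (intro Gamma_real_pos) auto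
  have cont: "continuous_on {0..} \<phi>"
  proof -
    have "continuous_on UNIV (mittag_leffler2 \<beta>)"
      using isCont_mittag_leffler2[OF \<beta>(1)] by (simp add: continuous_on_eq_continuous_at)
    moreover have "continuous_on {0..} (\<lambda>s. - (s powr \<beta>))"
      using \<beta> by (intro continuous_on_minus continuous_on_powr' continuous_on_id continuous_on_const) auto
    ultimately show ?thesis unfolding \<phi>_def by (rule continuous_on_compose2) simp
  qed
  define Z where "Z = {0..} \<inter> \<phi> -` {..0}"
  have "closed Z" unfolding Z_def by (intro continuous_closed_preimage cont) auto
  moreover have "x powr (1 / \<beta>) \<in> Z"
    using \<open>\<not> 0 < _\<close> \<beta> x by (auto simp: Z_def \<phi>_def powr_powr)
  moreover have bdd: "bdd_below Z" by (rule bdd_belowI[of _ 0]) (auto simp: Z_def)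
  ultimately have "Inf Z \<in> Z" using closed_contains_Inf by blast
  define t0 where "t0 = Inf Z"
  have "\<phi> t0 \<le> 0" "0 \<le> t0" using \<open>Inf Z \<in> Z\<close> by (auto simp: Z_def t0_def)
  have "\<phi> 0 > 0" using G by (simp add: \<phi>_def mittag_leffler2_0)
  with \<open>\<phi> t0 \<le> 0\<close> \<open>0 \<le> t0\<close> have t0: "0 < t0" by (cases "t0 = 0") auto
  have pos: "\<phi> s > 0" if "0 \<le> s" "s < t0" for s
    using cInf_lower[OF _ bdd, of s] that by (force simp: Z_def t0_def)
  note V = mittag_leffler2_Volterra[OF \<beta>(1), folded \<phi>_def, folded r_def]
  text \<open>Since \<open>(t0 - s) / t0 \<ge> (t - s) / t\<close>, the normalised kernel at the first zero \<open>t0\<close> is dominated by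
    the one at \<open>t < t0\<close>, so the mass of the convolution on \<open>[t, t0]\<close> must compensate for \<open>r t\<close>.\<close>
  have key: "Gamma \<beta> * r t / t powr (\<beta> - 1) \<le> integral {t..t0} (\<lambda>s. (t0 - s) powr (\<beta> - 1) * r s) / t0 powr (\<beta> - 1)"
    and int: "(\<lambda>s. (t0 - s) powr (\<beta> - 1) * r s) integrable_on {t..t0}"
    if t: "0 < t" "t < t0" for t
  proof -
    let ?f = "\<lambda>s. (t0 - s) powr (\<beta> - 1) * r s"
    have i0: "?f integrable_on {0..t0}" using V[OF t0] by blast
    then have i1: "?f integrable_on {0..t}" and i2: "?f integrable_on {t..t0}"
      using t by (auto elim!: integrable_on_subinterval)
    show "?f integrable_on {t..t0}" by fact
    have "integral {0..t} ?f + integral {t..t0} ?f = integral {0..t0} ?f"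
      using t i0 by (intro Henstock_Kurzweil_Integration.integral_combine) auto
    also have "\<dots> = t0 powr (\<beta> - 1) - Gamma \<beta> * r t0" using V[OF t0] by (rule integral_unique)
    also have "\<dots> \<ge> t0 powr (\<beta> - 1)"
      using \<open>\<phi> t0 \<le> 0\<close> G by (auto simp: r_def mult_nonneg_nonpos)
    finally have 1: "1 \<le> integral {0..t} ?f / t0 powr (\<beta> - 1) + integral {t..t0} ?f / t0 powr (\<beta> - 1)"
      using t0 by (simp add: field_simps)
    have "integral {0..t} ?f / t0 powr (\<beta> - 1) \<le> (t powr (\<beta> - 1) - Gamma \<beta> * r t) / t powr (\<beta> - 1)"
    proof (rule has_integral_le)
      \<comment> \<open>The comparison is made on the open interval: at \<open>s = t\<close> the
        kernel \<open>(t - s) powr (\<beta> - 1)\<close> takes the default value 0 and would not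
        dominate.\<close>
      show "((\<lambda>s. ?f s / t0 powr (\<beta> - 1)) has_integral integral {0..t} ?f / t0 powr (\<beta> - 1)) {0<..<t}"
        using i1 by (intro has_integral_divide) (auto simp flip: has_integral_Icc_iff_Ioo)
      show "((\<lambda>s. (t - s) powr (\<beta> - 1) * r s / t powr (\<beta> - 1)) has_integral
          (t powr (\<beta> - 1) - Gamma \<beta> * r t) / t powr (\<beta> - 1)) {0<..<t}"
        using V[OF t(1)] by (intro has_integral_divide) (auto simp flip: has_integral_Icc_iff_Ioo)
      fix s assume s: "s \<in> {0<..<t}"
      have "((t0 - s) / t0) powr (\<beta> - 1) \<le> ((t - s) / t) powr (\<beta> - 1)"
        using s t \<beta> by (intro powr_mono2') (auto simp: field_simps)
      then have "(t0 - s) powr (\<beta> - 1) / t0 powr (\<beta> - 1) \<le> (t - s) powr (\<beta> - 1) / t powr (\<beta> - 1)"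
        using s t by (simp add: powr_divide)
      moreover have "r s \<ge> 0" using pos[of s] s t by (simp add: r_def)
      ultimately show "?f s / t0 powr (\<beta> - 1) \<le> (t - s) powr (\<beta> - 1) * r s / t powr (\<beta> - 1)"
        by (metis mult_right_mono times_divide_eq_left)
    qed
    also have "\<dots> = 1 - Gamma \<beta> * r t / t powr (\<beta> - 1)" using t by (simp add: field_simps)
    finally show "Gamma \<beta> * r t / t powr (\<beta> - 1) \<le> integral {t..t0} ?f / t0 powr (\<beta> - 1)"
      using 1 by simp
  qed
  \<comment> \<open>The first bound gives \<open>t0 \<le> 2 * t\<close>, hence
    \<open>t powr (\<beta> - 1) \<le> 2 * t0 powr (\<beta> - 1)\<close>. The second makes the
    integral over \<open>[t, t0]\<close> at most a quarter of \<open>Gamma \<beta> * r t\<close>.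
    The contradiction will be 4 against 2.\<close>
  define \<delta> where "\<delta> = min (t0 / 2) ((Gamma \<beta> * \<beta> / 4) powr (1 / \<beta>))"
  have \<delta>: "0 < \<delta>" "\<delta> \<le> t0 / 2" using t0 G \<beta> by (auto simp: \<delta>_def G[THEN less_imp_neq, symmetric])
  have \<delta>': "\<delta> powr \<beta> \<le> Gamma \<beta> * \<beta> / 4"
  proof -
    have "\<delta> powr \<beta> \<le> ((Gamma \<beta> * \<beta> / 4) powr (1 / \<beta>)) powr \<beta>"
      using \<delta> \<beta> by (intro powr_mono2) (auto simp: \<delta>_def)
    then show ?thesis using \<beta> G by (simp add: powr_powr)
  qed
  have contr: "continuous_on {t0 - \<delta>..t0} r"
    unfolding r_def using \<delta> t0
    by (intro continuous_intros continuous_on_subset[OF cont]) auto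
  \<comment> \<open>At a maximum, \<open>r s\<close> may be replaced by \<open>r t\<close>
    throughout \<open>[t, t0]\<close>. The maximum is positive, so it is not attained at
    \<open>t0\<close>.\<close>
  obtain t where t: "t \<in> {t0 - \<delta>..t0}" and max: "\<And>s. s \<in> {t0 - \<delta>..t0} \<Longrightarrow> r s \<le> r t"
    using continuous_attains_sup[OF _ _ contr] \<delta> by auto
  have "r (t0 - \<delta>) > 0" using pos[of "t0 - \<delta>"] \<delta> t0 by (simp add: r_def)
  with max[of "t0 - \<delta>"] \<delta> have rt: "r t > 0" by simp
  with \<open>\<phi> t0 \<le> 0\<close> have "t \<noteq> t0" using mult_nonneg_nonpos[of "t0 powr (\<beta> - 1)" "\<phi> t0"] by (auto simp: r_def)
  with t \<delta> t0 have t': "0 < t" "t < t0" "t0 \<le> 2 * t" "t0 - t \<le> \<delta>" by auto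
  have K: "((\<lambda>s. (t0 - s) powr (\<beta> - 1) * r t) has_integral (t0 - t) powr \<beta> / \<beta> * r t) {t..t0}"
  proof -
    have "((\<lambda>s. (t0 - s) powr (\<beta> - 1)) has_integral (- ((t0 - t0) powr \<beta> / \<beta>) - (- ((t0 - t) powr \<beta> / \<beta>)))) {t..t0}"
    proof (rule fundamental_theorem_of_calculus_interior)
      show "continuous_on {t..t0} (\<lambda>s. - ((t0 - s) powr \<beta> / \<beta>))"
        using \<beta> by (intro continuous_on_minus continuous_on_divide continuous_on_powr' continuous_on_diff continuous_on_id continuous_on_const) auto
      fix s assume "s \<in> {t<..<t0}"
      then show "((\<lambda>s. - ((t0 - s) powr \<beta> / \<beta>)) has_vector_derivative (t0 - s) powr (\<beta> - 1)) (at s)"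
        unfolding has_real_derivative_iff_has_vector_derivative[symmetric]
        using \<beta> by (auto intro!: derivative_eq_intros simp: powr_diff)
    qed (use t' in auto)
    from has_integral_mult_left[OF this, of "r t"] show ?thesis by simp
  qed
  have "integral {t..t0} (\<lambda>s. (t0 - s) powr (\<beta> - 1) * r s) \<le> (t0 - t) powr \<beta> / \<beta> * r t"
    using t t' by (intro has_integral_le[OF integrable_integral[OF int[OF t'(1,2)]] K] mult_left_mono max) auto
  also have "\<dots> \<le> Gamma \<beta> / 4 * r t"
  proof (intro mult_right_mono)
    have "(t0 - t) powr \<beta> \<le> \<delta> powr \<beta>" using t' \<beta> by (intro powr_mono2) auto
    with \<delta>' show "(t0 - t) powr \<beta> / \<beta> \<le> Gamma \<beta> / 4" using \<beta> by (simp add: field_simps)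
  qed (use rt in simp)
  finally have "Gamma \<beta> * r t / t powr (\<beta> - 1) \<le> Gamma \<beta> / 4 * r t / t0 powr (\<beta> - 1)"
    using key[OF t'(1,2)] by (smt (verit) divide_right_mono powr_ge_zero)
  then have "t0 powr (\<beta> - 1) * 4 \<le> t powr (\<beta> - 1)"
    using G rt t' t0 by (simp add: field_simps)
  moreover have "t powr (\<beta> - 1) \<le> (t0 / 2) powr (\<beta> - 1)"
    using t' t0 \<beta> by (intro powr_mono2') auto
  moreover have "(t0 / 2) powr (\<beta> - 1) = t0 powr (\<beta> - 1) * 2 powr (1 - \<beta>)"
    using t0 by (simp add: powr_divide powr_diff field_simps)
  moreover have "t0 powr (\<beta> - 1) * 2 powr (1 - \<beta>) \<le> t0 powr (\<beta> - 1) * 2 powr 1"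
    using \<beta> by (intro mult_left_mono powr_mono) auto
  ultimately have "t0 powr (\<beta> - 1) * 4 \<le> t0 powr (\<beta> - 1) * 2 powr 1" by linarith
  then show False using t0 by simp
qed

text \<open>By positivity of \<open>r\<close> the Volterra convolution is nonnegative, so its value
  forces \<open>Gamma \<beta> * r t \<le> t powr (\<beta> - 1)\<close>.\<close>

lemma mittag_leffler2_le:
  fixes \<beta> x :: real
  assumes \<beta>: "0 < \<beta>" "\<beta> \<le> 1" and x: "0 \<le> x"
  shows "mittag_leffler2 \<beta> (- x) \<le> inverse (Gamma \<beta>)"
proof (cases "x = 0")
  case False
  define t where "t = x powr (1 / \<beta>)"
  have t: "0 < t" "t powr \<beta> = x" using x False \<beta> by (auto simp: t_def powr_powr)
  have "0 \<le> t powr (\<beta> - 1) - Gamma \<beta> * (t powr (\<beta> - 1) * mittag_leffler2 \<beta> (- (t powr \<beta>)))"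
    using mittag_leffler2_Volterra[OF \<beta>(1) t(1)] mittag_leffler2_pos[OF \<beta>]
    by (elim has_integral_nonneg) (simp add: less_imp_le)
  then have "t powr (\<beta> - 1) * (Gamma \<beta> * mittag_leffler2 \<beta> (- x)) \<le> t powr (\<beta> - 1) * 1"
    using t by (simp add: algebra_simps)
  then have "Gamma \<beta> * mittag_leffler2 \<beta> (- x) \<le> 1"
    using t by (subst (asm) mult_le_cancel_left_pos) auto
  then show ?thesis using Gamma_real_pos[OF \<beta>(1)] by (simp add: field_simps)
qed (simp add: mittag_leffler2_0)

lemma mittag_leffler_antimono:
  assumes \<beta>: "0 < \<beta>" "\<beta> \<le> 1" and "0 \<le> x" "x \<le> y"
  shows "mittag_leffler \<beta> (- y) \<le> mittag_leffler \<beta> (- x)"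
proof (rule DERIV_nonneg_imp_nondecreasing[of "- y" "- x" "mittag_leffler \<beta>"])
  fix s assume "- y \<le> s" "s \<le> - x"
  then have "0 \<le> inverse \<beta> * mittag_leffler2 \<beta> s"
    using mittag_leffler2_pos[OF \<beta>, of "- s"] \<open>0 \<le> x\<close> \<beta> by (simp add: less_imp_le)
  then show "\<exists>d. (mittag_leffler \<beta> has_real_derivative d) (at s) \<and> 0 \<le> d"
    using DERIV_mittag_leffler[OF \<beta>(1)] by blast
qed (use assms in simp)

text \<open>Integrating the derivative, \<open>1 - E_\<beta>(- t^\<beta>)\<close> is the integral of
  \<open>r\<close> over \<open>[0, t]\<close>. Since
  \<open>(t - s) powr (\<beta> - 1) \<ge> t powr (\<beta> - 1)\<close>, the Volterra equation bounds
  that integral by 1.\<close>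

lemma mittag_leffler_nonneg:
  fixes \<beta> x :: real
  assumes \<beta>: "0 < \<beta>" "\<beta> \<le> 1" and x: "0 \<le> x"
  shows "0 \<le> mittag_leffler \<beta> (- x)"
proof (cases "x = 0")
  case False
  define t where "t = x powr (1 / \<beta>)"
  have t: "0 < t" "t powr \<beta> = x" using x False \<beta> by (auto simp: t_def powr_powr)
  define r where "r s = s powr (\<beta> - 1) * mittag_leffler2 \<beta> (- (s powr \<beta>))" for s
  have r: "0 \<le> r s" for s using mittag_leffler2_pos[OF \<beta>, of "s powr \<beta>"] by (simp add: r_def less_imp_le)
  note V = mittag_leffler2_Volterra[OF \<beta>(1) t(1), folded r_def]
  have "(r has_integral (- mittag_leffler \<beta> (- (t powr \<beta>)) - (- mittag_leffler \<beta> (- (0 powr \<beta>))))) {0..t}"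
  proof (rule fundamental_theorem_of_calculus_interior)
    have "continuous_on UNIV (mittag_leffler \<beta>)"
      using DERIV_isCont[OF DERIV_mittag_leffler[OF \<beta>(1)]] by (simp add: continuous_on_eq_continuous_at)
    moreover have "continuous_on {0..t} (\<lambda>s. - (s powr \<beta>))"
      using \<beta> by (intro continuous_on_minus continuous_on_powr' continuous_on_id continuous_on_const) auto
    ultimately show "continuous_on {0..t} (\<lambda>s. - mittag_leffler \<beta> (- (s powr \<beta>)))"
      by (intro continuous_on_minus) (rule continuous_on_compose2, auto)
    fix s assume s: "s \<in> {0<..<t}"
    have "((\<lambda>s. - (s powr \<beta>)) has_real_derivative - (\<beta> * s powr (\<beta> - 1))) (at s)"
      using s by (auto intro!: derivative_eq_intros)
    note D = DERIV_minus[OF DERIV_chain2[OF DERIV_mittag_leffler[OF \<beta>(1)] this]]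
    show "((\<lambda>s. - mittag_leffler \<beta> (- (s powr \<beta>))) has_vector_derivative r s) (at s)"
      unfolding has_real_derivative_iff_has_vector_derivative[symmetric]
      by (rule DERIV_cong[OF D]) (use \<beta> in \<open>simp add: r_def\<close>)
  qed (use t in simp)
  then have "(r has_integral 1 - mittag_leffler \<beta> (- x)) {0..t}"
    using t by (simp add: mittag_leffler_0)
  from has_integral_mult_right[OF this, of "t powr (\<beta> - 1)"]
  have "t powr (\<beta> - 1) * (1 - mittag_leffler \<beta> (- x)) \<le> t powr (\<beta> - 1) - Gamma \<beta> * r t"
    unfolding has_integral_Icc_iff_Ioo
  proof (rule has_integral_le)
    \<comment> \<open>Open interval again, because the kernel is 0 by convention at
      \<open>s = t\<close>.\<close>
    show "((\<lambda>s. (t - s) powr (\<beta> - 1) * r s) has_integral t powr (\<beta> - 1) - Gamma \<beta> * r t) {0<..<t}"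
      using V by (simp flip: has_integral_Icc_iff_Ioo)
    fix s assume "s \<in> {0<..<t}"
    then show "t powr (\<beta> - 1) * r s \<le> (t - s) powr (\<beta> - 1) * r s"
      using r \<beta> by (intro mult_right_mono powr_mono2') auto
  qed
  also have "\<dots> \<le> t powr (\<beta> - 1) * 1" using r Gamma_real_pos[OF \<beta>(1)] by simp
  finally have "1 - mittag_leffler \<beta> (- x) \<le> 1"
    using t by (subst (asm) mult_le_cancel_left_pos) auto
  then show ?thesis by simp
qed (simp add: mittag_leffler_0)

lemma mittag_leffler_le_1:
  assumes "0 < \<beta>" "\<beta> \<le> 1" "0 \<le> x"
  shows "mittag_leffler \<beta> (- x) \<le> 1"
  using mittag_leffler_antimono[OF assms(1,2) order_refl assms(3)] by (simp add: mittag_leffler_0)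

text \<open>Mean value bound: on \<open>{..0}\<close> the derivative
  \<open>E_{\<beta>,\<beta>} / \<beta>\<close> lies between 0 and
  \<open>1 / (\<beta> * Gamma \<beta>)\<close>.\<close>

lemma mittag_leffler_Lipschitz:
  assumes \<beta>: "0 < \<beta>" "\<beta> \<le> 1" and xy: "0 \<le> x" "0 \<le> y"
  shows "\<bar>mittag_leffler \<beta> (- x) - mittag_leffler \<beta> (- y)\<bar> \<le> inverse (\<beta> * Gamma \<beta>) * \<bar>x - y\<bar>"
proof -
  have "norm (mittag_leffler \<beta> (- x) - mittag_leffler \<beta> (- y)) \<le> inverse (\<beta> * Gamma \<beta>) * norm (- x - - y)"
  proof (rule field_differentiable_bound[where S = "{..0}"])
    fix s :: real assume s: "s \<in> {..0}"
    show "(mittag_leffler \<beta> has_field_derivative inverse \<beta> * mittag_leffler2 \<beta> s) (at s within {..0})"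
      by (rule DERIV_subset[OF DERIV_mittag_leffler[OF \<beta>(1)]]) simp
    show "norm (inverse \<beta> * mittag_leffler2 \<beta> s) \<le> inverse (\<beta> * Gamma \<beta>)"
      using mittag_leffler2_pos[OF \<beta>, of "- s"] mittag_leffler2_le[OF \<beta>, of "- s"] \<beta> s
      by (simp add: abs_mult)
  qed (use xy in \<open>auto\<close>)
  then show ?thesis by (simp add: abs_minus_commute)
qed

text \<open>Interpolation between the Lipschitz bound and the trivial bound \<open>1\<close>.\<close>
lemma mittag_leffler_Holder:
  assumes \<beta>: "0 < \<beta>" "\<beta> \<le> 1" and xy: "0 \<le> x" "0 \<le> y" and \<theta>: "0 < \<theta>" "\<theta> \<le> 1"
  shows "\<bar>mittag_leffler \<beta> (- x) - mittag_leffler \<beta> (- y)\<bar> \<le> (inverse (\<beta> * Gamma \<beta>) * \<bar>x - y\<bar>) powr \<theta>"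
proof -
  let ?d = "\<bar>mittag_leffler \<beta> (- x) - mittag_leffler \<beta> (- y)\<bar>"
  have "?d \<le> 1"
    using mittag_leffler_nonneg[OF \<beta> xy(1)] mittag_leffler_nonneg[OF \<beta> xy(2)]
      mittag_leffler_le_1[OF \<beta> xy(1)] mittag_leffler_le_1[OF \<beta> xy(2)] by linarith
  then have "?d \<le> ?d powr \<theta>"
    using powr_mono'[of \<theta> 1 ?d] \<theta> by (cases "?d = 0") auto
  also have "\<dots> \<le> (inverse (\<beta> * Gamma \<beta>) * \<bar>x - y\<bar>) powr \<theta>"
    using mittag_leffler_Lipschitz[OF \<beta> xy] \<theta> by (intro powr_mono2) auto
  finally show ?thesis .
qed

section \<open>Square integrability of the Fourier transform\<close>

text \<open>The characteristic function of a centred normal law, rescaled to the standard one. It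
  turns a Gaussian weight in frequency into a Gaussian kernel in space.\<close>

lemma integral_cis_normal_density:
  assumes "0 < \<sigma>"
  shows "(LINT l|lborel. normal_density 0 \<sigma> l *\<^sub>R cis (z * l)) = exp (- (\<sigma> * z)\<^sup>2 / 2)"
proof -
  have "(LINT l|lborel. normal_density 0 \<sigma> l *\<^sub>R cis (z * l)) =
      \<sigma> *\<^sub>R (LINT l|lborel. normal_density 0 \<sigma> (0 + \<sigma> * l) *\<^sub>R cis (z * (0 + \<sigma> * l)))"
    using lborel_integral_real_affine[of \<sigma> "\<lambda>l. normal_density 0 \<sigma> l *\<^sub>R cis (z * l)" 0] assms by simp
  also have "\<dots> = (LINT l|lborel. std_normal_density l *\<^sub>R iexp (\<sigma> * z * l))"
  proof -
    have nd: "\<sigma> * normal_density 0 \<sigma> (\<sigma> * l) = std_normal_density l" for l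
      using assms by (simp add: normal_density_def real_sqrt_mult power_mult_distrib)
    have "\<sigma> *\<^sub>R (normal_density 0 \<sigma> (0 + \<sigma> * l) *\<^sub>R cis (z * (0 + \<sigma> * l))) =
        std_normal_density l *\<^sub>R iexp (\<sigma> * z * l)" for l
      unfolding scaleR_scaleR add_0 nd by (simp add: cis_conv_exp mult_ac)
    then show ?thesis by (simp flip: integral_scaleR_right)
  qed
  also have "\<dots> = char std_normal_distribution (\<sigma> * z)"
    unfolding char_def by (subst integral_density) (auto simp: mult.assoc)
  finally show ?thesis by (simp add: char_std_normal_distribution)
qed

lemma Fourier_integral_measurable [measurable]:
  fixes f :: "real \<Rightarrow> real"
  assumes [measurable]: "f \<in> borel_measurable borel"
  shows "(\<lambda>l. LINT y|lborel. cis (- l * y) * complex_of_real (f y)) \<in> borel_measurable borel"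
proof -
  have [measurable]: "cis \<in> borel_measurable borel"
    by (intro borel_measurable_continuous_onI continuous_intros)
  show ?thesis by measurable
qed


lemma integrable_mult_pair:
  fixes g h :: "real \<Rightarrow> real"
  assumes "integrable lborel g" "integrable lborel h"
  shows "integrable (lborel \<Otimes>\<^sub>M lborel) (\<lambda>(x, y). g x * h y)"
  by (rule lborel_pair.Fubini_integrable) (use assms in \<open>auto simp: abs_mult\<close>)

lemma norm_Fourier_integral_le:
  fixes f :: "real \<Rightarrow> real"
  shows "norm (LINT y|lborel. cis (- l * y) * complex_of_real (f y)) \<le> (LINT y|lborel. \<bar>f y\<bar>)"
  using integral_norm_bound[of lborel "\<lambda>y. cis (- l * y) * complex_of_real (f y)"] by (simp add: norm_mult)

text \<open>Write \<open>|G|^2\<close> as \<open>G\<close> times its conjugate and expand both. The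
  Gaussian weight makes every exchange of integrals absolutely convergent, and the integral over
  \<open>l\<close> is a characteristic function at \<open>y - x\<close>.\<close>

lemma Gaussian_double_integral:
  fixes f :: "real \<Rightarrow> real" and \<sigma> :: real
  assumes f [measurable]: "integrable lborel f" and \<sigma>: "0 < \<sigma>"
  defines "G \<equiv> \<lambda>l. LINT y|lborel. cis (- l * y) * complex_of_real (f y)"
  shows "(LINT l|lborel. normal_density 0 \<sigma> l * (cmod (G l))\<^sup>2) =
    (LINT x|lborel. f x * (LINT y|lborel. f y * exp (- (\<sigma> * (y - x))\<^sup>2 / 2)))"
proof -
  have [measurable]: "f \<in> borel_measurable borel" using f by auto
  have cis [measurable]: "cis \<in> borel_measurable borel"
    by (intro borel_measurable_continuous_onI continuous_intros)
  have G [measurable]: "G \<in> borel_measurable borel" unfolding G_def by measurable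
  have [measurable]: "cnj \<in> borel_measurable borel"
    by (intro borel_measurable_continuous_onI continuous_intros)
  define B where "B = (LINT y|lborel. \<bar>f y\<bar>)"
  have GB: "norm (G l) \<le> B" for l unfolding G_def B_def by (rule norm_Fourier_integral_le)
  have B: "0 \<le> B" by (simp add: B_def)
  let ?n = "normal_density 0 \<sigma>"
  have n: "integrable lborel ?n" using \<sigma> by simp
  \<comment> \<open>The conjugate factor stays unexpanded here and is merely bounded by the L1 norm
    of \<open>f\<close>. Two planar applications of Fubini, this one and \<open>int2\<close>, thus
    replace a threefold product.\<close>
  have int1: "integrable (lborel \<Otimes>\<^sub>M lborel) (\<lambda>(x, l). ?n l *\<^sub>R (cis (- l * x) * complex_of_real (f x) * cnj (G l)))"
  proof (rule Bochner_Integration.integrable_bound)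
    show "integrable (lborel \<Otimes>\<^sub>M lborel) (\<lambda>(x, l). f x * (?n l * B))"
      by (intro integrable_mult_pair f integrable_mult_left n)
    show "AE z in lborel \<Otimes>\<^sub>M lborel. norm (case z of (x, l) \<Rightarrow> ?n l *\<^sub>R (cis (- l * x) * complex_of_real (f x) * cnj (G l)))
        \<le> norm (case z of (x, l) \<Rightarrow> f x * (?n l * B))"
    proof (intro AE_I2, clarify)
      fix x l
      have "\<bar>f x\<bar> * (?n l * cmod (G l)) \<le> \<bar>f x\<bar> * (?n l * B)"
        by (intro mult_left_mono GB) auto
      then show "norm (?n l *\<^sub>R (cis (- l * x) * complex_of_real (f x) * cnj (G l))) \<le> norm (f x * (?n l * B))"
        using B by (simp add: norm_mult abs_mult mult_ac)
    qed
  qed measurable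
  have int2: "integrable (lborel \<Otimes>\<^sub>M lborel) (\<lambda>(y, l). ?n l *\<^sub>R (cis ((y - x) * l) * complex_of_real (f y)))" for x
  proof (rule Bochner_Integration.integrable_bound)
    show "integrable (lborel \<Otimes>\<^sub>M lborel) (\<lambda>(y, l). f y * ?n l)"
      by (intro integrable_mult_pair f n)
    show "AE z in lborel \<Otimes>\<^sub>M lborel. norm (case z of (y, l) \<Rightarrow> ?n l *\<^sub>R (cis ((y - x) * l) * complex_of_real (f y)))
        \<le> norm (case z of (y, l) \<Rightarrow> f y * ?n l)"
      by (intro AE_I2) (auto simp: norm_mult abs_mult mult_ac)
  qed measurable
  have inner: "(LINT l|lborel. ?n l *\<^sub>R (cis (- l * x) * complex_of_real (f x) * cnj (G l))) =
      complex_of_real (f x * (LINT y|lborel. f y * exp (- (\<sigma> * (y - x))\<^sup>2 / 2)))" for x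
  proof -
    have step: "?n l *\<^sub>R (cis (- l * x) * complex_of_real (f x) * cnj (G l)) =
        complex_of_real (f x) * (LINT y|lborel. ?n l *\<^sub>R (cis ((y - x) * l) * complex_of_real (f y)))" for l
    proof -
      have "cnj (G l) = (LINT y|lborel. cnj (cis (- l * y) * complex_of_real (f y)))"
        unfolding G_def by (rule Bochner_Integration.integral_cnj[symmetric])
      also have "\<dots> = (LINT y|lborel. cis (l * y) * complex_of_real (f y))"
        by (intro Bochner_Integration.integral_cong) (simp_all add: cis_cnj)
      finally have cnj: "cnj (G l) = (LINT y|lborel. cis (l * y) * complex_of_real (f y))" .
      have "?n l *\<^sub>R (cis (- l * x) * complex_of_real (f x) * cnj (G l)) =
          complex_of_real (f x) * (?n l *\<^sub>R (cis (- l * x) * (LINT y|lborel. cis (l * y) * complex_of_real (f y))))"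
        unfolding cnj by (simp add: mult_ac)
      also have "cis (- l * x) * (LINT y|lborel. cis (l * y) * complex_of_real (f y)) =
          (LINT y|lborel. cis ((y - x) * l) * complex_of_real (f y))"
        unfolding Bochner_Integration.integral_mult_right_zero[symmetric]
        by (simp only: mult.assoc[symmetric] cis_mult) (simp add: algebra_simps)
      finally show ?thesis by simp
    qed
    have gauss: "(LINT l|lborel. ?n l *\<^sub>R (cis ((y - x) * l) * complex_of_real (f y))) =
        complex_of_real (f y * exp (- (\<sigma> * (y - x))\<^sup>2 / 2))" for y
    proof -
      have "(LINT l|lborel. ?n l *\<^sub>R (cis ((y - x) * l) * complex_of_real (f y))) =
         (LINT l|lborel. ?n l *\<^sub>R cis ((y - x) * l)) * complex_of_real (f y)"
        by (subst Bochner_Integration.integral_mult_left_zero[symmetric]) simp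
      then show ?thesis by (simp only: integral_cis_normal_density[OF \<sigma>]) (simp add: mult.commute)
    qed
    have "(LINT l|lborel. ?n l *\<^sub>R (cis (- l * x) * complex_of_real (f x) * cnj (G l))) =
        complex_of_real (f x) * (LINT l|lborel. LINT y|lborel. ?n l *\<^sub>R (cis ((y - x) * l) * complex_of_real (f y)))"
      unfolding step by (rule Bochner_Integration.integral_mult_right_zero)
    also have "(LINT l|lborel. LINT y|lborel. ?n l *\<^sub>R (cis ((y - x) * l) * complex_of_real (f y))) =
        (LINT y|lborel. LINT l|lborel. ?n l *\<^sub>R (cis ((y - x) * l) * complex_of_real (f y)))"
      by (rule lborel_pair.Fubini_integral[OF int2])
    also have "\<dots> = complex_of_real (LINT y|lborel. f y * exp (- (\<sigma> * (y - x))\<^sup>2 / 2))"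
      unfolding gauss integral_complex_of_real ..
    finally show ?thesis by (simp only: of_real_mult)
  qed
  have "complex_of_real (LINT l|lborel. ?n l * (cmod (G l))\<^sup>2) = (LINT l|lborel. ?n l *\<^sub>R (G l * cnj (G l)))"
    unfolding integral_complex_of_real[symmetric]
    by (simp only: of_real_mult complex_norm_square scaleR_conv_of_real)
  also have "\<dots> = (LINT l|lborel. LINT x|lborel. ?n l *\<^sub>R (cis (- l * x) * complex_of_real (f x) * cnj (G l)))"
    unfolding G_def by (simp del: complex_cnj_mult)
  also have "\<dots> = (LINT x|lborel. LINT l|lborel. ?n l *\<^sub>R (cis (- l * x) * complex_of_real (f x) * cnj (G l)))"
    by (rule lborel_pair.Fubini_integral[OF int1])
  also have "\<dots> = complex_of_real (LINT x|lborel. f x * (LINT y|lborel. f y * exp (- (\<sigma> * (y - x))\<^sup>2 / 2)))"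
    unfolding inner integral_complex_of_real ..
  finally show ?thesis by (simp only: of_real_eq_iff)
qed

text \<open>A Schur test: \<open>|f x| * |f y|\<close> is at most the mean of the squares, and the
  Gaussian kernel has the same total mass in either variable. That mass cancels the normalisation of
  the weight, so the bound is uniform in \<open>\<sigma>\<close>.\<close>

lemma Fourier_integral_Gaussian_bound:
  fixes f :: "real \<Rightarrow> real" and \<sigma> :: real
  assumes f: "integrable lborel f" and \<sigma>: "0 < \<sigma>"
  defines "G \<equiv> \<lambda>l. LINT y|lborel. cis (- l * y) * complex_of_real (f y)"
  shows "(\<integral>\<^sup>+l. ennreal (exp (- l\<^sup>2 / (2 * \<sigma>\<^sup>2)) * (cmod (G l))\<^sup>2) \<partial>lborel) \<le>
    ennreal (2 * pi) * (\<integral>\<^sup>+x. ennreal ((f x)\<^sup>2) \<partial>lborel)"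
proof -
  have [measurable]: "f \<in> borel_measurable borel" using f by auto
  have G [measurable]: "G \<in> borel_measurable borel" unfolding G_def by measurable
  define B where "B = (LINT y|lborel. \<bar>f y\<bar>)"
  have GB: "norm (G l) \<le> B" for l unfolding G_def B_def by (rule norm_Fourier_integral_le)
  let ?n = "normal_density 0 \<sigma>"
  \<comment> \<open>The mass of the unnormalised kernel \<open>e x\<close>; the product
    \<open>\<sigma> * sqrt (2 * pi) * K\<close> equals \<open>2 * pi\<close>.\<close>
  define K where "K = sqrt (2 * pi) / \<sigma>"
  have K: "0 < K" using \<sigma> by (simp add: K_def)
  define e where "e x y = exp (- (\<sigma> * (y - x))\<^sup>2 / 2)" for x y :: real
  have [measurable]: "case_prod e \<in> borel_measurable (borel \<Otimes>\<^sub>M borel)"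
    unfolding e_def by measurable
  have e_pos: "0 \<le> e x y" for x y by (simp add: e_def)
  have e: "(\<integral>\<^sup>+y. ennreal (e x y) \<partial>lborel) = ennreal K" for x
  proof -
    have "e x y = K * normal_density x (1 / \<sigma>) y" for y
      using \<sigma> by (simp add: e_def K_def normal_density_def power_mult_distrib power_divide real_sqrt_divide real_sqrt_mult)
    then have "(\<integral>\<^sup>+y. ennreal (e x y) \<partial>lborel) = ennreal (LINT y|lborel. K * normal_density x (1 / \<sigma>) y)"
      using \<sigma> K by (simp only:) (intro nn_integral_eq_integral, auto)
    then show ?thesis using \<sigma> by simp
  qed
  have e': "(\<integral>\<^sup>+x. ennreal (e x y) \<partial>lborel) = ennreal K" for y
    using e[of y] by (simp add: e_def power_mult_distrib power2_commute)
  have "(\<integral>\<^sup>+l. ennreal (?n l * (cmod (G l))\<^sup>2) \<partial>lborel) = ennreal (LINT l|lborel. ?n l * (cmod (G l))\<^sup>2)"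
  proof (rule nn_integral_eq_integral)
    show "integrable lborel (\<lambda>l. ?n l * (cmod (G l))\<^sup>2)"
    proof (rule Bochner_Integration.integrable_bound)
      show "integrable lborel (\<lambda>l. ?n l * B\<^sup>2)" using \<sigma> by simp
      show "AE l in lborel. norm (?n l * (cmod (G l))\<^sup>2) \<le> norm (?n l * B\<^sup>2)"
        using GB by (intro AE_I2) (auto simp: abs_mult intro!: mult_left_mono power_mono)
    qed measurable
  qed simp
  also have "\<dots> = ennreal (LINT x|lborel. f x * (LINT y|lborel. f y * e x y))"
    unfolding G_def e_def Gaussian_double_integral[OF f \<sigma>] ..
  also have "\<dots> \<le> (\<integral>\<^sup>+x. ennreal \<bar>f x * (LINT y|lborel. f y * e x y)\<bar> \<partial>lborel)"
  \<comment> \<open>Without integrability the Bochner integral defaults to 0 and the bound is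
    trivial.\<close>
  proof (cases "integrable lborel (\<lambda>x. f x * (LINT y|lborel. f y * e x y))")
    case True
    have "ennreal (LINT x|lborel. f x * (LINT y|lborel. f y * e x y)) \<le>
        ennreal (norm (LINT x|lborel. f x * (LINT y|lborel. f y * e x y)))"
      by (intro ennreal_leI) simp
    also have "\<dots> \<le> (\<integral>\<^sup>+x. ennreal (norm (f x * (LINT y|lborel. f y * e x y))) \<partial>lborel)"
      by (rule integral_norm_bound_ennreal[OF True])
    finally show ?thesis by simp
  qed (simp add: not_integrable_integral_eq)
  also have "\<dots> \<le> (\<integral>\<^sup>+x. \<integral>\<^sup>+y. ennreal (\<bar>f x\<bar> * \<bar>f y\<bar> * e x y) \<partial>lborel \<partial>lborel)"
  proof (rule nn_integral_mono)
    fix x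
    have int: "integrable lborel (\<lambda>y. f y * e x y)"
      by (rule Bochner_Integration.integrable_bound[OF f])
        (auto simp: e_def abs_mult intro!: mult_left_le)
    have "ennreal \<bar>f x * (LINT y|lborel. f y * e x y)\<bar> = ennreal \<bar>f x\<bar> * ennreal (norm (LINT y|lborel. f y * e x y))"
      by (simp add: abs_mult ennreal_mult)
    also have "\<dots> \<le> ennreal \<bar>f x\<bar> * (\<integral>\<^sup>+y. ennreal (norm (f y * e x y)) \<partial>lborel)"
      by (intro mult_left_mono integral_norm_bound_ennreal[OF int]) simp
    also have "\<dots> = (\<integral>\<^sup>+y. ennreal \<bar>f x\<bar> * ennreal (norm (f y * e x y)) \<partial>lborel)"
      by (subst nn_integral_cmult) measurable
    finally show "ennreal \<bar>f x * (LINT y|lborel. f y * e x y)\<bar> \<le> (\<integral>\<^sup>+y. ennreal (\<bar>f x\<bar> * \<bar>f y\<bar> * e x y) \<partial>lborel)"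
      using e_pos by (simp add: abs_mult ennreal_mult mult_ac)
  qed
  also have "\<dots> \<le> (\<integral>\<^sup>+x. \<integral>\<^sup>+y. ennreal ((f x)\<^sup>2 / 2) * ennreal (e x y) + ennreal ((f y)\<^sup>2 / 2) * ennreal (e x y) \<partial>lborel \<partial>lborel)"
  proof (intro nn_integral_mono)
    fix x y
    have "\<bar>f x\<bar> * \<bar>f y\<bar> \<le> (f x)\<^sup>2 / 2 + (f y)\<^sup>2 / 2"
      using sum_squares_bound[of "\<bar>f x\<bar>" "\<bar>f y\<bar>"] by simp
    from mult_right_mono[OF this e_pos]
    have "\<bar>f x\<bar> * \<bar>f y\<bar> * e x y \<le> (f x)\<^sup>2 / 2 * e x y + (f y)\<^sup>2 / 2 * e x y"
      by (simp add: distrib_right)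
    then show "ennreal (\<bar>f x\<bar> * \<bar>f y\<bar> * e x y) \<le> ennreal ((f x)\<^sup>2 / 2) * ennreal (e x y) + ennreal ((f y)\<^sup>2 / 2) * ennreal (e x y)"
      using e_pos by (simp add: ennreal_mult[symmetric] ennreal_plus[symmetric] ennreal_leI del: ennreal_plus)
  qed
  also have "\<dots> = (\<integral>\<^sup>+x. \<integral>\<^sup>+y. ennreal ((f x)\<^sup>2 / 2) * ennreal (e x y) \<partial>lborel \<partial>lborel) +
      (\<integral>\<^sup>+x. \<integral>\<^sup>+y. ennreal ((f y)\<^sup>2 / 2) * ennreal (e x y) \<partial>lborel \<partial>lborel)"
    by (simp add: nn_integral_add)
  also have "(\<integral>\<^sup>+x. \<integral>\<^sup>+y. ennreal ((f y)\<^sup>2 / 2) * ennreal (e x y) \<partial>lborel \<partial>lborel) =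
      (\<integral>\<^sup>+y. \<integral>\<^sup>+x. ennreal ((f y)\<^sup>2 / 2) * ennreal (e x y) \<partial>lborel \<partial>lborel)"
    by (rule lborel_pair.Fubini') measurable
  also have "(\<integral>\<^sup>+x. \<integral>\<^sup>+y. ennreal ((f x)\<^sup>2 / 2) * ennreal (e x y) \<partial>lborel \<partial>lborel) +
      (\<integral>\<^sup>+y. \<integral>\<^sup>+x. ennreal ((f y)\<^sup>2 / 2) * ennreal (e x y) \<partial>lborel \<partial>lborel) =
      (\<integral>\<^sup>+x. ennreal ((f x)\<^sup>2 / 2) * ennreal K \<partial>lborel) + (\<integral>\<^sup>+x. ennreal ((f x)\<^sup>2 / 2) * ennreal K \<partial>lborel)"
    using e e' by (simp add: nn_integral_cmult)
  also have "\<dots> = (\<integral>\<^sup>+x. ennreal K * ennreal ((f x)\<^sup>2) \<partial>lborel)"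
    using K by (subst nn_integral_add[symmetric], measurable)
      (auto intro!: nn_integral_cong simp: ennreal_mult[symmetric] ennreal_plus[symmetric] simp del: ennreal_plus)
  finally have *: "(\<integral>\<^sup>+l. ennreal (?n l * (cmod (G l))\<^sup>2) \<partial>lborel) \<le> ennreal K * (\<integral>\<^sup>+x. ennreal ((f x)\<^sup>2) \<partial>lborel)"
    by (simp add: nn_integral_cmult)
  have "exp (- l\<^sup>2 / (2 * \<sigma>\<^sup>2)) = (\<sigma> * sqrt (2 * pi)) * ?n l" for l
    using \<sigma> by (simp add: normal_density_def real_sqrt_mult)
  then have "(\<integral>\<^sup>+l. ennreal (exp (- l\<^sup>2 / (2 * \<sigma>\<^sup>2)) * (cmod (G l))\<^sup>2) \<partial>lborel) =
      (\<integral>\<^sup>+l. ennreal (\<sigma> * sqrt (2 * pi)) * ennreal (?n l * (cmod (G l))\<^sup>2) \<partial>lborel)"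
    using \<sigma> by (intro nn_integral_cong) (simp add: ennreal_mult[symmetric] mult.assoc)
  also have "\<dots> = ennreal (\<sigma> * sqrt (2 * pi)) * (\<integral>\<^sup>+l. ennreal (?n l * (cmod (G l))\<^sup>2) \<partial>lborel)"
    by (rule nn_integral_cmult) measurable
  also have "\<dots> \<le> ennreal (\<sigma> * sqrt (2 * pi)) * (ennreal K * (\<integral>\<^sup>+x. ennreal ((f x)\<^sup>2) \<partial>lborel))"
    by (intro mult_left_mono *) simp
  also have "\<dots> = ennreal (2 * pi) * (\<integral>\<^sup>+x. ennreal ((f x)\<^sup>2) \<partial>lborel)"
  proof -
    have "\<sigma> * sqrt (2 * pi) * K = 2 * pi" using \<sigma> by (simp add: K_def)
    then show ?thesis using \<sigma> K by (simp add: mult.assoc[symmetric] ennreal_mult[symmetric])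
  qed
  finally show ?thesis .
qed

text \<open>The Gaussian weights of width \<open>n + 1\<close> tend to 1 pointwise; Fatou's lemma
  removes them from the uniform bound.\<close>

lemma Fourier_integral_L2_bound:
  fixes f :: "real \<Rightarrow> real"
  assumes f: "integrable lborel f"
  defines "G \<equiv> \<lambda>l. LINT y|lborel. cis (- l * y) * complex_of_real (f y)"
  shows "(\<integral>\<^sup>+l. ennreal ((cmod (G l))\<^sup>2) \<partial>lborel) \<le>
    ennreal (2 * pi) * (\<integral>\<^sup>+x. ennreal ((f x)\<^sup>2) \<partial>lborel)"
proof -
  have [measurable]: "f \<in> borel_measurable borel" using f by auto
  have G [measurable]: "G \<in> borel_measurable borel" unfolding G_def by measurable
  let ?u = "\<lambda>n l. ennreal (exp (- l\<^sup>2 / (2 * (real (Suc n))\<^sup>2)) * (cmod (G l))\<^sup>2)"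
  have lim: "(\<lambda>n. ?u n l) \<longlonglongrightarrow> ennreal ((cmod (G l))\<^sup>2)" for l
  proof (rule tendsto_ennrealI)
    have "(\<lambda>n. - l\<^sup>2 / 2 * (inverse (real (Suc n)))\<^sup>2) \<longlonglongrightarrow> - l\<^sup>2 / 2 * 0\<^sup>2"
      by (intro tendsto_intros LIMSEQ_inverse_real_of_nat)
    also have "(\<lambda>n. - l\<^sup>2 / 2 * (inverse (real (Suc n)))\<^sup>2) = (\<lambda>n. - l\<^sup>2 / (2 * (real (Suc n))\<^sup>2))"
      by (simp add: fun_eq_iff field_simps power2_eq_square del: of_nat_Suc)
    finally have "(\<lambda>n. - l\<^sup>2 / (2 * (real (Suc n))\<^sup>2)) \<longlonglongrightarrow> 0" by simp
    from tendsto_mult_right[OF tendsto_exp[OF this], of "(cmod (G l))\<^sup>2"]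
    show "(\<lambda>n. exp (- l\<^sup>2 / (2 * (real (Suc n))\<^sup>2)) * (cmod (G l))\<^sup>2) \<longlonglongrightarrow> (cmod (G l))\<^sup>2" by simp
  qed
  have "(\<integral>\<^sup>+l. ennreal ((cmod (G l))\<^sup>2) \<partial>lborel) = (\<integral>\<^sup>+l. liminf (\<lambda>n. ?u n l) \<partial>lborel)"
    using lim_imp_Liminf[OF _ lim] by (intro nn_integral_cong) simp
  also have "\<dots> \<le> liminf (\<lambda>n. integral\<^sup>N lborel (?u n))"
    by (rule nn_integral_liminf) measurable
  also have "\<dots> \<le> ennreal (2 * pi) * (\<integral>\<^sup>+x. ennreal ((f x)\<^sup>2) \<partial>lborel)"
    unfolding G_def
    by (intro Liminf_le always_eventually allI Fourier_integral_Gaussian_bound[OF f]) simp_all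
  finally show ?thesis .
qed


section \<open>From truncated transforms to the L2 transform\<close>

lemma cmod_add_squared_le: "ennreal ((cmod (a + b))\<^sup>2) \<le> 2 * ennreal ((cmod a)\<^sup>2) + 2 * ennreal ((cmod b)\<^sup>2)"
proof -
  have "(cmod (a + b))\<^sup>2 \<le> (cmod a + cmod b)\<^sup>2" by (intro power_mono norm_triangle_ineq) simp
  also have "\<dots> \<le> 2 * (cmod a)\<^sup>2 + 2 * (cmod b)\<^sup>2"
    using sum_squares_bound[of "cmod a" "cmod b"] by (simp add: power2_sum)
  finally have "ennreal ((cmod (a + b))\<^sup>2) \<le> ennreal (2 * (cmod a)\<^sup>2 + 2 * (cmod b)\<^sup>2)"
    by (rule ennreal_leI)
  then show ?thesis by (simp add: ennreal_mult)
qed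

text \<open>\<open>F\<close> is the L2 limit of the transforms \<open>G n\<close> of truncations of
  \<open>f\<close>. Each \<open>G n\<close> has finite L2 norm by the Plancherel inequality and is
  exactly Hermitian because \<open>f\<close> is real; both properties survive the limit, the
  symmetry almost everywhere.\<close>

lemma l2_fourier_transform_hermitian_L2:
  assumes fm: "f \<in> borel_measurable lborel" and f2: "integrable lborel (\<lambda>y. (f y)\<^sup>2)"
    and F: "l2_fourier_transform f F"
  shows "hermitian_L2 F"
proof -
  have [measurable]: "f \<in> borel_measurable borel" using fm by simp
  define \<phi> where "\<phi> n y = indicator {- real n..real n} y * f y" for n y
  have [measurable]: "\<phi> n \<in> borel_measurable borel" for n unfolding \<phi>_def by measurable
  define G where "G n l = (LINT y|lborel. cis (- l * y) * complex_of_real (\<phi> n y))" for n l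
  have [measurable]: "G n \<in> borel_measurable borel" for n unfolding G_def by measurable
  have [measurable]: "F \<in> borel_measurable borel" using F by (simp add: l2_fourier_transform_def)
  have [measurable]: "cnj \<in> borel_measurable borel"
    by (intro borel_measurable_continuous_onI continuous_intros)
  \<comment> \<open>On a bounded interval \<open>|f| \<le> 1 + f^2\<close> puts the truncation in
    L1.\<close>
  have \<phi>1: "integrable lborel (\<phi> n)" for n
  proof (rule Bochner_Integration.integrable_bound)
    show "integrable lborel (\<lambda>y. indicator {- real n..real n} y + (f y)\<^sup>2)"
      using f2 by (intro Bochner_Integration.integrable_add) auto
    show "AE y in lborel. norm (\<phi> n y) \<le> norm (indicator {- real n..real n} y + (f y)\<^sup>2)"
    proof (rule AE_I2)
      fix y
      have "\<bar>f y\<bar> \<le> 1 + (f y)\<^sup>2"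
        using sum_squares_bound[of 1 "\<bar>f y\<bar>"] by (simp add: power2_eq_square)
      then show "norm (\<phi> n y) \<le> norm (indicator {- real n..real n} y + (f y)\<^sup>2)"
        by (simp add: \<phi>_def indicator_def)
    qed
  qed simp
  define a where "a n = (\<integral>\<^sup>+l. ennreal ((cmod (F l - G n l))\<^sup>2) \<partial>lborel)" for n
  have "G n l = set_lebesgue_integral lborel {- real n..real n} (\<lambda>y. cis (- l * y) * complex_of_real (f y))" for n l
    unfolding G_def \<phi>_def set_lebesgue_integral_def
    by (intro Bochner_Integration.integral_cong refl) (simp add: indicator_def)
  then have a: "a \<longlonglongrightarrow> 0"
    using F by (simp add: l2_fourier_transform_def a_def[abs_def])
  \<comment> \<open>A single index at finite distance from \<open>F\<close> suffices for finiteness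
    of the norm.\<close>
  have "eventually (\<lambda>n. a n < 1) sequentially" using a by (rule order_tendstoD) simp
  then obtain n where n: "a n < 1" by (auto simp: eventually_sequentially)
  have Gfin: "(\<integral>\<^sup>+l. ennreal ((cmod (G n l))\<^sup>2) \<partial>lborel) < \<infinity>"
  proof -
    have "(\<integral>\<^sup>+l. ennreal ((cmod (G n l))\<^sup>2) \<partial>lborel) \<le> ennreal (2 * pi) * (\<integral>\<^sup>+x. ennreal ((\<phi> n x)\<^sup>2) \<partial>lborel)"
      unfolding G_def by (rule Fourier_integral_L2_bound[OF \<phi>1])
    also have "\<dots> \<le> ennreal (2 * pi) * (\<integral>\<^sup>+x. ennreal ((f x)\<^sup>2) \<partial>lborel)"
      by (intro mult_left_mono nn_integral_mono ennreal_leI) (auto simp: \<phi>_def indicator_def)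
    also have "\<dots> < \<infinity>"
      using f2 by (simp add: nn_integral_eq_integral ennreal_mult_less_top)
    finally show ?thesis .
  qed
  have "(\<integral>\<^sup>+l. ennreal ((cmod (F l))\<^sup>2) \<partial>lborel) \<le>
      (\<integral>\<^sup>+l. 2 * ennreal ((cmod (F l - G n l))\<^sup>2) + 2 * ennreal ((cmod (G n l))\<^sup>2) \<partial>lborel)"
    using cmod_add_squared_le[of "F l - G n l" "G n l" for l] by (intro nn_integral_mono) simp
  also have "\<dots> = 2 * a n + 2 * (\<integral>\<^sup>+l. ennreal ((cmod (G n l))\<^sup>2) \<partial>lborel)"
    by (simp add: nn_integral_add nn_integral_cmult a_def)
  also have "\<dots> < \<infinity>"
    using n Gfin by (auto simp: ennreal_mult_less_top intro: order.strict_trans)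
  finally have fin: "(\<integral>\<^sup>+l. ennreal ((cmod (F l))\<^sup>2) \<partial>lborel) < \<infinity>" .
  \<comment> \<open>The squared L2 defect of Hermitian symmetry. Passing through \<open>G n\<close>,
    and using that reflection preserves Lebesgue measure, bounds it by \<open>4 * a n\<close> for
    every \<open>n\<close>.\<close>
  define D where "D = (\<integral>\<^sup>+l. ennreal ((cmod (F (- l) - cnj (F l)))\<^sup>2) \<partial>lborel)"
  have D: "D \<le> 2 * a n + 2 * a n" for n
  proof -
    have herm: "G n (- l) = cnj (G n l)" for l
    proof -
      have "cnj (G n l) = (LINT y|lborel. cnj (cis (- l * y) * complex_of_real (\<phi> n y)))"
        unfolding G_def by (rule Bochner_Integration.integral_cnj[symmetric])
      also have "\<dots> = (LINT y|lborel. cis (- (- l) * y) * complex_of_real (\<phi> n y))"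
        by (intro Bochner_Integration.integral_cong) (simp_all add: cis_cnj)
      finally show ?thesis unfolding G_def ..
    qed
    have "D \<le> (\<integral>\<^sup>+l. 2 * ennreal ((cmod (F (- l) - G n (- l)))\<^sup>2) + 2 * ennreal ((cmod (F l - G n l))\<^sup>2) \<partial>lborel)"
      unfolding D_def
    proof (rule nn_integral_mono)
      fix l
      have "F (- l) - cnj (F l) = (F (- l) - G n (- l)) + cnj (G n l - F l)"
        by (simp add: herm)
      moreover have "cmod (cnj (G n l - F l)) = cmod (F l - G n l)"
        by (simp only: complex_mod_cnj norm_minus_commute)
      ultimately show "ennreal ((cmod (F (- l) - cnj (F l)))\<^sup>2) \<le>
          2 * ennreal ((cmod (F (- l) - G n (- l)))\<^sup>2) + 2 * ennreal ((cmod (F l - G n l))\<^sup>2)"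
        using cmod_add_squared_le[of "F (- l) - G n (- l)" "cnj (G n l - F l)"] by simp
    qed
    also have "\<dots> = 2 * (\<integral>\<^sup>+l. ennreal ((cmod (F (- l) - G n (- l)))\<^sup>2) \<partial>lborel) + 2 * a n"
      by (simp add: nn_integral_add nn_integral_cmult a_def)
    also have "(\<integral>\<^sup>+l. ennreal ((cmod (F (- l) - G n (- l)))\<^sup>2) \<partial>lborel) = a n"
      using nn_integral_real_affine[of "\<lambda>l. ennreal ((cmod (F l - G n l))\<^sup>2)" "-1" 0]
      by (simp add: a_def)
    finally show ?thesis .
  qed
  have "(\<lambda>n. 2 * a n + 2 * a n) \<longlonglongrightarrow> 2 * 0 + 2 * 0"
    by (intro tendsto_add ennreal_tendsto_cmult a) auto
  then have "D \<le> 0" using D by (intro LIMSEQ_le_const) auto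
  then have "AE l in lborel. ennreal ((cmod (F (- l) - cnj (F l)))\<^sup>2) = 0"
    unfolding D_def by (subst nn_integral_0_iff_AE[symmetric]) auto
  then have "AE l in lborel. F (- l) = cnj (F l)"
    by eventually_elim (simp add: ennreal_eq_0_iff)
  with fin show ?thesis by (simp add: hermitian_L2_def)
qed

section \<open>Moments of Gaussian variables\<close>

text \<open>Equal characteristic functions determine the law. Scaling a standard normal variable by
  \<open>sqrt v\<close> includes the degenerate case \<open>v = 0\<close>, where no density
  exists.\<close>

lemma centered_gaussian_distr:
  assumes M: "prob_space M" and X: "centered_gaussian M X v" and v: "0 \<le> v"
  shows "distr M borel X = distr std_normal_distribution borel (\<lambda>z. sqrt v * z)"
proof (rule Levy_uniqueness)
  interpret M: prob_space M by (rule M)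
  have [measurable]: "X \<in> borel_measurable M" using X by (simp add: centered_gaussian_def)
  show "real_distribution (distr M borel X)" by (rule M.real_distribution_distr) simp
  interpret N: real_distribution std_normal_distribution by (rule real_dist_normal_dist)
  show "real_distribution (distr std_normal_distribution borel (\<lambda>z. sqrt v * z))"
    by (rule N.real_distribution_distr) simp
  show "char (distr M borel X) = char (distr std_normal_distribution borel (\<lambda>z. sqrt v * z))"
  proof
    fix \<theta>
    have "char (distr std_normal_distribution borel (\<lambda>z. sqrt v * z)) \<theta> =
        char std_normal_distribution (\<theta> * sqrt v)"
      unfolding char_def by (subst integral_distr) (simp_all add: mult.assoc)
    also have "\<dots> = exp (- v * \<theta>\<^sup>2 / 2)"
      using v by (simp add: char_std_normal_distribution power_mult_distrib mult.commute)
    finally show "char (distr M borel X) \<theta> = char (distr std_normal_distribution borel (\<lambda>z. sqrt v * z)) \<theta>"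
      using X by (simp add: centered_gaussian_def)
  qed
qed

text \<open>By scaling, the moment of order \<open>2 * k\<close> is a constant times the k-th power
  of the variance, so one variance estimate controls increments in arbitrarily high moments.\<close>

lemma centered_gaussian_even_moment:
  assumes M: "prob_space M" and X: "centered_gaussian M X v" and v: "0 \<le> v"
  shows "(\<integral>\<^sup>+\<omega>. ennreal (X \<omega> ^ (2 * k)) \<partial>M) = ennreal (fact (2 * k) / (2 ^ k * fact k) * v ^ k)"
proof -
  have [measurable]: "X \<in> borel_measurable M" using X by (simp add: centered_gaussian_def)
  have "(\<integral>\<^sup>+\<omega>. ennreal (X \<omega> ^ (2 * k)) \<partial>M) = (\<integral>\<^sup>+x. ennreal (x ^ (2 * k)) \<partial>distr M borel X)"
    by (subst nn_integral_distr) simp_all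
  also have "\<dots> = (\<integral>\<^sup>+x. ennreal ((sqrt v * x) ^ (2 * k)) \<partial>std_normal_distribution)"
    unfolding centered_gaussian_distr[OF assms] by (subst nn_integral_distr) simp_all
  also have "\<dots> = (\<integral>\<^sup>+x. ennreal (v ^ k * x ^ (2 * k)) \<partial>std_normal_distribution)"
    using v by (simp add: power_mult_distrib power_mult)
  also have "\<dots> = ennreal (LINT x|std_normal_distribution. v ^ k * x ^ (2 * k))"
    using v std_normal_distribution_even_moments(2)[of k]
    by (intro nn_integral_eq_integral) (auto intro!: mult_nonneg_nonneg simp: power_mult)
  also have "\<dots> = ennreal (fact (2 * k) / (2 ^ k * fact k) * v ^ k)"
    by (subst Bochner_Integration.integral_mult_right_zero, subst std_normal_distribution_even_moments(1))
      (simp only: mult.commute)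
  finally show ?thesis .
qed

section \<open>The Kolmogorov-Chentsov criterion\<close>

lemma geometric_increments_limit:
  fixes x :: "nat \<Rightarrow> real"
  assumes q: "0 \<le> q" "q < 1" and x: "\<And>n. \<bar>x (Suc n) - x n\<bar> \<le> K * q ^ n"
  shows "convergent x" "\<bar>lim x - x n\<bar> \<le> K * q ^ n / (1 - q)"
proof -
  have "summable (\<lambda>n. K * q ^ n)" using q by (intro summable_mult summable_geometric) auto
  then have "summable (\<lambda>n. x (Suc n) - x n)"
    by (rule summable_comparison_test[rotated]) (use x in auto)
  then have "convergent (\<lambda>n. \<Sum>i<n. x (Suc i) - x i)" by (simp add: summable_iff_convergent)
  then have "convergent (\<lambda>n. (x n - x 0) + x 0)"
    unfolding sum_lessThan_telescope by (intro convergent_add convergent_const)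
  then show conv: "convergent x" by simp
  have K: "0 \<le> K" using x[of 0] by simp
  have "\<bar>x (n + m) - x n\<bar> \<le> K * q ^ n / (1 - q)" for m
  proof -
    have "\<bar>x (n + m) - x n\<bar> \<le> K * q ^ n * (\<Sum>i<m. q ^ i)"
    proof (induction m)
      case (Suc m)
      then show ?case using x[of "n + m"] by (simp add: power_add algebra_simps)
    qed simp
    also have "\<dots> \<le> K * q ^ n * (1 / (1 - q))"
      using q K sum_le_suminf[OF summable_geometric, of q "{..<m}"]
      by (intro mult_left_mono) (auto simp: suminf_geometric)
    finally show ?thesis by simp
  qed
  moreover have "(\<lambda>m. \<bar>x (n + m) - x n\<bar>) \<longlonglongrightarrow> \<bar>lim x - x n\<bar>"
    using LIMSEQ_ignore_initial_segment[OF convergent_LIMSEQ_iff[THEN iffD1, OF conv], of n]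
    by (intro tendsto_intros) (simp add: add.commute)
  ultimately show "\<bar>lim x - x n\<bar> \<le> K * q ^ n / (1 - q)"
    by (intro LIMSEQ_le_const2) auto
qed

text \<open>The level-n grid point just left of \<open>t\<close>. Negative values are clipped to 0
  by \<open>nat\<close>, so the result always lies in the range of the moment hypothesis.\<close>

definition dyadic_floor :: "nat \<Rightarrow> real \<Rightarrow> real" where
  "dyadic_floor n t = real (nat \<lfloor>2 ^ n * t\<rfloor>) / 2 ^ n"

lemma dyadic_floor_nonneg: "0 \<le> dyadic_floor n t"
  by (simp add: dyadic_floor_def)

lemma dyadic_floor_dist:
  assumes "0 \<le> t"
  shows "\<bar>dyadic_floor n t - t\<bar> \<le> (1 / 2) ^ n"
proof -
  have eq: "real (nat \<lfloor>2 ^ n * t\<rfloor>) = real_of_int \<lfloor>2 ^ n * t\<rfloor>" using assms by simp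
  have "real (nat \<lfloor>2 ^ n * t\<rfloor>) \<le> 2 ^ n * t" "2 ^ n * t \<le> real (nat \<lfloor>2 ^ n * t\<rfloor>) + 1"
    unfolding eq by linarith+
  then have "\<bar>real (nat \<lfloor>2 ^ n * t\<rfloor>) - 2 ^ n * t\<bar> \<le> 1" by linarith
  then have "\<bar>real (nat \<lfloor>2 ^ n * t\<rfloor>) - 2 ^ n * t\<bar> / 2 ^ n \<le> 1 / 2 ^ n"
    by (rule divide_right_mono) simp
  also have "\<bar>real (nat \<lfloor>2 ^ n * t\<rfloor>) - 2 ^ n * t\<bar> / 2 ^ n = \<bar>dyadic_floor n t - t\<bar>"
  proof -
    have "dyadic_floor n t - t = (real (nat \<lfloor>2 ^ n * t\<rfloor>) - 2 ^ n * t) / 2 ^ n"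
      by (simp add: dyadic_floor_def diff_divide_distrib)
    then show ?thesis by (simp add: abs_divide)
  qed
  finally show ?thesis by (simp add: power_one_over)
qed

text \<open>Refining the level moves the approximating grid point by at most one cell, so the values
  form a Cauchy sequence with geometric rate. Two points closer than \<open>2 ^ (- n)\<close> have
  equal or adjacent approximations at level \<open>n\<close>. No regularity of \<open>f\<close> off
  the grid enters, because the conclusion concerns the limit along the grid.\<close>

lemma dyadic_chaining:
  fixes f :: "real \<Rightarrow> real" and N :: nat
  assumes \<gamma>: "0 < \<gamma>"
    and incr: "\<And>n k. k < N * 2 ^ n \<Longrightarrow>
      \<bar>f (real (Suc k) / 2 ^ n) - f (real k / 2 ^ n)\<bar> \<le> K * (2 powr - \<gamma>) ^ n"
  shows "holder_on {0..real N} (\<lambda>t. lim (\<lambda>n. f (dyadic_floor n t))) \<gamma>"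
\<comment> \<open>For \<open>N = 0\<close> the increment hypothesis is vacuous and says nothing
  about the sign of \<open>K\<close>; the interval is then a single point.\<close>
proof (cases "N = 0")
  case True
  then show ?thesis by (auto simp: holder_on_def)
next
  case False
  define q where "q = 2 powr - \<gamma>"
  have q: "0 < q" "q < 1" using \<gamma> by (auto simp: q_def powr_minus_divide)
  define c where "c = 1 / (1 - q)"
  have c: "0 < c" using q by (simp add: c_def)
  have K: "0 \<le> K" using incr[of 0 0] False by simp
  define Y where "Y t = lim (\<lambda>n. f (dyadic_floor n t))" for t
  have bnd: "nat \<lfloor>2 ^ n * t\<rfloor> \<le> N * 2 ^ n" if "t \<le> real N" for n t
  proof -
    have "2 ^ n * t \<le> real (N * 2 ^ n)" using that by simp
    then show ?thesis by linarith
  qed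
  have near: "\<bar>Y t - f (dyadic_floor n t)\<bar> \<le> K * q ^ n * c" if t: "0 \<le> t" "t \<le> real N" for n t
  proof -
    have "\<bar>f (dyadic_floor (Suc n) t) - f (dyadic_floor n t)\<bar> \<le> K * q ^ n" for n
    proof -
      define m where "m = nat \<lfloor>2 ^ n * t\<rfloor>"
      define m' where "m' = nat \<lfloor>2 ^ Suc n * t\<rfloor>"
      have "real m \<le> 2 ^ n * t" "2 ^ n * t < real m + 1" "real m' \<le> 2 ^ Suc n * t" "2 ^ Suc n * t < real m' + 1"
        using t by (auto simp: m_def m'_def of_nat_nat)
      \<comment> \<open>Doubling a number doubles its floor or doubles it plus one.\<close>
      then have "m' = 2 * m \<or> m' = Suc (2 * m)" by simp linarith
      moreover have "m' \<le> N * 2 ^ Suc n" using bnd[OF t(2)] by (simp only: m'_def)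
      ultimately consider "m' = 2 * m" | "m' = Suc (2 * m)" "2 * m < N * 2 ^ Suc n" by linarith
      then show ?thesis
      proof cases
        case 1
        then have "dyadic_floor (Suc n) t = dyadic_floor n t"
          unfolding dyadic_floor_def m_def[symmetric] m'_def[symmetric] by simp
        then show ?thesis using K q by simp
      next
        case 2
        have "real m / 2 ^ n = real (2 * m) / 2 ^ Suc n" by simp
        then have "\<bar>f (dyadic_floor (Suc n) t) - f (dyadic_floor n t)\<bar> \<le> K * q ^ Suc n"
          using incr[OF 2(2)] 2(1) unfolding dyadic_floor_def m_def[symmetric] m'_def[symmetric] q_def by simp
        also have "\<dots> \<le> K * q ^ n" using K q by (intro mult_left_mono) (auto simp: mult_le_cancel_right1)
        finally show ?thesis .
      qed
    qed
    from geometric_increments_limit(2)[of q "\<lambda>n. f (dyadic_floor n t)" K n, OF _ _ this] q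
    show ?thesis by (simp add: Y_def c_def)
  qed
  \<comment> \<open>Level 0 is allowed at any distance: chaining over at most \<open>N\<close> unit
    cells costs the factor \<open>real N + 1\<close>, which also covers adjacent cells at higher
    levels.\<close>
  have level: "\<bar>Y t - Y s\<bar> \<le> K * (real N + 1 + 2 * c) * q ^ n"
    if s: "0 \<le> s" "s \<le> t" "t \<le> real N" and n: "n = 0 \<or> 2 ^ n * (t - s) < 1" for s t n
  proof -
    have "\<bar>f (dyadic_floor n t) - f (dyadic_floor n s)\<bar> \<le> K * (real N + 1) * q ^ n"
    proof (cases "2 ^ n * (t - s) < 1")
      case True
      define i where "i = nat \<lfloor>2 ^ n * s\<rfloor>"
      define j where "j = nat \<lfloor>2 ^ n * t\<rfloor>"
      have "2 ^ n * s \<le> 2 ^ n * t" using s by simp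
      then have "\<lfloor>2 ^ n * s\<rfloor> \<le> \<lfloor>2 ^ n * t\<rfloor>" by (rule floor_mono)
      moreover have "2 ^ n * t < 2 ^ n * s + 1" using True by (simp add: algebra_simps)
      then have "\<lfloor>2 ^ n * t\<rfloor> \<le> \<lfloor>2 ^ n * s\<rfloor> + 1" by linarith
      moreover have "0 \<le> \<lfloor>2 ^ n * s\<rfloor>" using s by simp
      ultimately have "j = i \<or> j = Suc i" unfolding i_def j_def by linarith
      moreover have "j \<le> N * 2 ^ n" using bnd s by (simp add: j_def)
      ultimately have "\<bar>f (real j / 2 ^ n) - f (real i / 2 ^ n)\<bar> \<le> K * q ^ n"
        using incr[of i n] K q by (auto simp: q_def)
      also have "\<dots> \<le> K * (real N + 1) * q ^ n"
        using K q by (intro mult_right_mono) (auto simp: mult_le_cancel_left1)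
      finally show ?thesis by (simp add: dyadic_floor_def i_def j_def)
    next
      case False
      with n have n: "n = 0" by simp
      define i where "i = nat \<lfloor>s\<rfloor>"
      define j where "j = nat \<lfloor>t\<rfloor>"
      have ij: "i \<le> j" "j \<le> N" using s bnd[of t 0] by (auto simp: i_def j_def floor_mono nat_mono)
      have "\<bar>f (real (i + l)) - f (real i)\<bar> \<le> K * real l" if "i + l \<le> N" for l
        using that
      proof (induction l)
        case (Suc l)
        have "\<bar>f (real (Suc (i + l))) - f (real (i + l))\<bar> \<le> K" using incr[of "i + l" 0] Suc.prems by simp
        with Suc show ?case by (simp add: algebra_simps)
      qed simp
      from this[of "j - i"] ij have "\<bar>f (real j) - f (real i)\<bar> \<le> K * real (j - i)" by simp
      also have "\<dots> \<le> K * (real N + 1)" using ij K by (intro mult_left_mono) auto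
      finally show ?thesis by (simp add: dyadic_floor_def i_def j_def n)
    qed
    moreover have "\<bar>Y t - f (dyadic_floor n t)\<bar> \<le> K * q ^ n * c" "\<bar>Y s - f (dyadic_floor n s)\<bar> \<le> K * q ^ n * c"
      using near s by auto
    ultimately have "\<bar>Y t - Y s\<bar> \<le> K * (real N + 1) * q ^ n + K * q ^ n * c + K * q ^ n * c" by linarith
    then show ?thesis by (simp add: algebra_simps)
  qed
  define C where "C = K * (real N + 1 + 2 * c)"
  have C: "0 \<le> C" using K c by (simp add: C_def)
  have main: "\<bar>Y t - Y s\<bar> \<le> C * 2 powr \<gamma> * \<bar>t - s\<bar> powr \<gamma>" if s: "0 \<le> s" "s \<le> t" "t \<le> real N" for s t
  proof -
    consider "s = t" | "s < t" "t - s < 1" | "1 \<le> t - s" using s by linarith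
    then show ?thesis
    proof cases
      case 2
      \<comment> \<open>With \<open>m\<close> least, the level \<open>n = m - 1\<close> satisfies
        \<open>t - s < 2 ^ (- n)\<close> while \<open>2 ^ (- m) \<le> t - s\<close>. The shift by
        one costs the factor \<open>2 powr \<gamma>\<close>, and \<open>m\<close> is nonzero since
        \<open>t - s < 1\<close>.\<close>
      define m where "m = (LEAST m. (1 / 2 :: real) ^ m \<le> t - s)"
      have ex: "\<exists>m. (1 / 2 :: real) ^ m \<le> t - s"
        using real_arch_pow_inv[of "t - s" "1 / 2"] 2 by (auto intro: less_imp_le)
      have m: "(1 / 2 :: real) ^ m \<le> t - s" unfolding m_def by (rule LeastI_ex[OF ex])
      with 2 obtain n where n: "m = Suc n" by (cases m) auto
      have "\<not> (1 / 2 :: real) ^ n \<le> t - s" using not_less_Least[of n] n by (metis lessI m_def)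
      then have "2 ^ n * (t - s) < 1" by (simp add: power_one_over field_simps)
      then have "\<bar>Y t - Y s\<bar> \<le> C * q ^ n" using level[OF s, of n] by (simp add: C_def)
      also have "q ^ n = 2 powr \<gamma> * ((1 / 2) ^ m) powr \<gamma>"
      proof -
        have "q ^ n = 2 powr \<gamma> * q ^ m" by (simp add: n q_def powr_minus)
        moreover have "q = (1 / 2) powr \<gamma>" by (simp add: q_def powr_minus_divide powr_divide)
        ultimately show ?thesis by (simp add: powr_power powr_powr flip: powr_realpow) (simp add: mult.commute)
      qed
      also have "C * (2 powr \<gamma> * ((1 / 2) ^ m) powr \<gamma>) \<le> C * (2 powr \<gamma> * (t - s) powr \<gamma>)"
        using C \<gamma> m by (intro mult_left_mono powr_mono2) auto
      finally show ?thesis using 2 by (simp add: mult.assoc)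
    next
      case 3
      have "\<bar>Y t - Y s\<bar> \<le> C * (1 * 1)" using level[OF s, of 0] by (simp add: C_def)
      also have "\<dots> \<le> C * (2 powr \<gamma> * (t - s) powr \<gamma>)"
        using C \<gamma> 3 by (intro mult_left_mono mult_mono ge_one_powr_ge_zero) auto
      finally show ?thesis using 3 by (simp add: mult.assoc)
    qed simp
  qed
  show ?thesis
    unfolding holder_on_def Y_def[symmetric]
  proof (intro exI ballI)
    fix t s assume "t \<in> {0..real N}" "s \<in> {0..real N}"
    then show "\<bar>Y t - Y s\<bar> \<le> C * 2 powr \<gamma> * \<bar>t - s\<bar> powr \<gamma>"
      using main[of s t] main[of t s] by (cases "s \<le> t") (auto simp: abs_minus_commute)
  qed
qed

section \<open>Almost sure bounds from moments\<close>

lemma root_even_power_abs: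
  assumes "0 < k"
  shows "root (2 * k) (x ^ (2 * k)) = \<bar>x\<bar>"
proof -
  have "x ^ (2 * k) = \<bar>x\<bar> ^ (2 * k)" by (simp add: power_even_abs)
  then show ?thesis using assms real_root_power_cancel[of "2 * k" "\<bar>x\<bar>"] by simp
qed

text \<open>Exchanging sum and integral makes the sum of the \<open>u n\<close> have finite
  expectation; this plays the part of Markov's inequality with Borel-Cantelli.\<close>

lemma nn_integral_suminf_finite_AE:
  fixes u :: "nat \<Rightarrow> 'a \<Rightarrow> ennreal"
  assumes [measurable]: "\<And>n. u n \<in> borel_measurable M"
    and le: "\<And>n. (\<integral>\<^sup>+\<omega>. u n \<omega> \<partial>M) \<le> ennreal (b n)" and b: "summable b" "\<And>n. 0 \<le> b n"
  shows "AE \<omega> in M. (\<Sum>n. u n \<omega>) \<noteq> \<infinity>"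
proof (rule nn_integral_PInf_AE)
  have "(\<integral>\<^sup>+\<omega>. (\<Sum>n. u n \<omega>) \<partial>M) = (\<Sum>n. \<integral>\<^sup>+\<omega>. u n \<omega> \<partial>M)" by (rule nn_integral_suminf) simp
  also have "\<dots> \<le> (\<Sum>n. ennreal (b n))" using le by (intro suminf_le) auto
  also have "\<dots> = ennreal (\<Sum>n. b n)" using b by (intro suminf_ennreal2) auto
  finally show "(\<integral>\<^sup>+\<omega>. (\<Sum>n. u n \<omega>) \<partial>M) \<noteq> \<infinity>" by (auto simp: top_unique)
qed measurable

text \<open>Summable moments are used twice: along the grid approximations of one fixed
  \<open>t\<close>, to identify the limit with \<open>X t\<close>, and over all grid increments in
  \<open>[0, N]\<close>, to feed the chaining bound. \<open>Y\<close> is defined independently of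
  \<open>N\<close>, so the countably many null sets can be joined.\<close>

theorem Kolmogorov_Chentsov:
  fixes X :: "real \<Rightarrow> 'a \<Rightarrow> real" and k :: nat
  assumes X [measurable]: "\<And>t. X t \<in> borel_measurable M"
    and moment: "\<And>s t. 0 \<le> s \<Longrightarrow> 0 \<le> t \<Longrightarrow>
      (\<integral>\<^sup>+\<omega>. ennreal ((X t \<omega> - X s \<omega>) ^ (2 * k)) \<partial>M) \<le> ennreal (C * \<bar>t - s\<bar> powr r)"
    and k: "0 < k" and C: "0 \<le> C" and \<gamma>: "0 < \<gamma>" and r: "1 + 2 * real k * \<gamma> < r"
  defines "Y \<equiv> \<lambda>t \<omega>. lim (\<lambda>n. X (dyadic_floor n t) \<omega>)"
  shows "\<And>t. Y t \<in> borel_measurable M"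
    and "\<And>t. 0 \<le> t \<Longrightarrow> AE \<omega> in M. Y t \<omega> = X t \<omega>"
    and "AE \<omega> in M. \<forall>N::nat. holder_on {0..real N} (\<lambda>t. Y t \<omega>) \<gamma>"
proof -
  have r0: "0 < r" using r \<gamma> by (smt (verit) mult_nonneg_nonneg of_nat_0_le_iff)
  show "Y t \<in> borel_measurable M" for t unfolding Y_def by measurable
  show "AE \<omega> in M. Y t \<omega> = X t \<omega>" if t: "0 \<le> t" for t
  proof -
    have "AE \<omega> in M. (\<Sum>n. ennreal ((X (dyadic_floor n t) \<omega> - X t \<omega>) ^ (2 * k))) \<noteq> \<infinity>"
    proof (rule nn_integral_suminf_finite_AE)
      fix n
      have "(\<integral>\<^sup>+\<omega>. ennreal ((X (dyadic_floor n t) \<omega> - X t \<omega>) ^ (2 * k)) \<partial>M) \<le> ennreal (C * \<bar>dyadic_floor n t - t\<bar> powr r)"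
        by (intro moment t dyadic_floor_nonneg)
      also have "\<dots> \<le> ennreal (C * ((1 / 2) powr r) ^ n)"
      proof (intro ennreal_leI mult_left_mono C)
        have "\<bar>dyadic_floor n t - t\<bar> powr r \<le> ((1 / 2) ^ n) powr r"
          using dyadic_floor_dist[OF t] r0 by (intro powr_mono2) auto
        then show "\<bar>dyadic_floor n t - t\<bar> powr r \<le> ((1 / 2) powr r) ^ n"
          by (simp add: powr_power powr_powr mult.commute flip: powr_realpow)
      qed
      finally show "(\<integral>\<^sup>+\<omega>. ennreal ((X (dyadic_floor n t) \<omega> - X t \<omega>) ^ (2 * k)) \<partial>M) \<le> ennreal (C * ((1 / 2) powr r) ^ n)" .
      have "((1 / 2) powr r :: real) < 1" using powr_less_mono2[of r "1 / 2" 1] r0 by simp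
      then show "summable (\<lambda>n. C * ((1 / 2) powr r) ^ n)" by (intro summable_mult summable_geometric) auto
      show "0 \<le> C * ((1 / 2) powr r) ^ n" using C by simp
    qed measurable
    then show ?thesis
    proof eventually_elim
      case (elim \<omega>)
      then have "summable (\<lambda>n. (X (dyadic_floor n t) \<omega> - X t \<omega>) ^ (2 * k))"
        by (intro summable_suminf_not_top) (auto simp: power_mult)
      then have "(\<lambda>n. (X (dyadic_floor n t) \<omega> - X t \<omega>) ^ (2 * k)) \<longlonglongrightarrow> 0"
        by (rule summable_LIMSEQ_zero)
      from tendsto_real_root[OF this, of "2 * k"]
      have "(\<lambda>n. \<bar>X (dyadic_floor n t) \<omega> - X t \<omega>\<bar>) \<longlonglongrightarrow> 0"
        using k by (simp add: root_even_power_abs)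
      then have "(\<lambda>n. X (dyadic_floor n t) \<omega>) \<longlonglongrightarrow> X t \<omega>"
        by (simp add: tendsto_rabs_zero_iff LIM_zero_iff)
      then show ?case unfolding Y_def by (rule limI)
    qed
  qed
  have "AE \<omega> in M. holder_on {0..real N} (\<lambda>t. Y t \<omega>) \<gamma>" for N :: nat
  proof -
    define q where "q = 2 powr - \<gamma>"
    have q: "0 < q" by (simp add: q_def)
    \<comment> \<open>All level-n increments measured against their target size
      \<open>q ^ n\<close>; a finite sum over \<open>n\<close> bounds each of them by a random
      multiple of \<open>q ^ n\<close>.\<close>
    define u where "u n \<omega> = (\<Sum>j<N * 2 ^ n. ennreal (((X (real (Suc j) / 2 ^ n) \<omega> - X (real j / 2 ^ n) \<omega>) / q ^ n) ^ (2 * k)))" for n \<omega>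
    \<comment> \<open>Level \<open>n\<close> has \<open>N * 2 ^ n\<close> increments, each of scaled
      moment at most \<open>C * 2 powr (n * (2 * k * \<gamma> - r))\<close>. The ratio
      \<open>\<rho>\<close> is below 1 precisely by the hypothesis on \<open>r\<close>.\<close>
    define \<rho> where "\<rho> = 2 powr (1 + 2 * real k * \<gamma> - r)"
    have "AE \<omega> in M. (\<Sum>n. u n \<omega>) \<noteq> \<infinity>"
    proof (rule nn_integral_suminf_finite_AE)
      show "u n \<in> borel_measurable M" for n unfolding u_def by measurable
      have "\<rho> < 1" using r by (simp add: \<rho>_def powr_less_one)
      then show "summable (\<lambda>n. real N * C * \<rho> ^ n)"
        by (intro summable_mult summable_geometric) (auto simp: \<rho>_def)
      fix n
      show "0 \<le> real N * C * \<rho> ^ n" using C by (simp add: \<rho>_def)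
      have "(\<integral>\<^sup>+\<omega>. u n \<omega> \<partial>M) = (\<Sum>j<N * 2 ^ n. \<integral>\<^sup>+\<omega>. ennreal (((X (real (Suc j) / 2 ^ n) \<omega> - X (real j / 2 ^ n) \<omega>) / q ^ n) ^ (2 * k)) \<partial>M)"
        unfolding u_def by (rule nn_integral_sum) measurable
      also have "\<dots> \<le> (\<Sum>j<N * 2 ^ n. ennreal ((1 / q ^ n) ^ (2 * k) * (C * ((1 / 2) ^ n) powr r)))"
      proof (rule sum_mono)
        fix j
        have "(\<integral>\<^sup>+\<omega>. ennreal (((X (real (Suc j) / 2 ^ n) \<omega> - X (real j / 2 ^ n) \<omega>) / q ^ n) ^ (2 * k)) \<partial>M) =
            (\<integral>\<^sup>+\<omega>. ennreal ((1 / q ^ n) ^ (2 * k)) * ennreal ((X (real (Suc j) / 2 ^ n) \<omega> - X (real j / 2 ^ n) \<omega>) ^ (2 * k)) \<partial>M)"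
          using q by (intro nn_integral_cong) (simp add: ennreal_mult'[symmetric] power_divide)
        also have "\<dots> = ennreal ((1 / q ^ n) ^ (2 * k)) * (\<integral>\<^sup>+\<omega>. ennreal ((X (real (Suc j) / 2 ^ n) \<omega> - X (real j / 2 ^ n) \<omega>) ^ (2 * k)) \<partial>M)"
          by (rule nn_integral_cmult) measurable
        also have "\<dots> \<le> ennreal ((1 / q ^ n) ^ (2 * k)) * ennreal (C * \<bar>real (Suc j) / 2 ^ n - real j / 2 ^ n\<bar> powr r)"
          by (intro mult_left_mono moment) auto
        also have "\<bar>real (Suc j) / 2 ^ n - real j / 2 ^ n\<bar> = (1 / 2) ^ n"
          by (simp add: diff_divide_distrib[symmetric] power_one_over)
        finally show "(\<integral>\<^sup>+\<omega>. ennreal (((X (real (Suc j) / 2 ^ n) \<omega> - X (real j / 2 ^ n) \<omega>) / q ^ n) ^ (2 * k)) \<partial>M)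
            \<le> ennreal ((1 / q ^ n) ^ (2 * k) * (C * ((1 / 2) ^ n) powr r))"
          using q C by (simp add: ennreal_mult)
      qed
      also have "\<dots> = ennreal (real (N * 2 ^ n) * ((1 / q ^ n) ^ (2 * k) * (C * ((1 / 2) ^ n) powr r)))"
        using q C by (simp add: ennreal_mult ennreal_of_nat_eq_real_of_nat)
      also have "real (N * 2 ^ n) * ((1 / q ^ n) ^ (2 * k) * (C * ((1 / 2) ^ n) powr r)) = real N * C * \<rho> ^ n"
      proof -
        have "(1 / q ^ n) ^ (2 * k) = 2 powr (real n * (2 * real k * \<gamma>))"
          by (simp add: q_def powr_minus power_inverse powr_power field_simps)
        moreover have "((1 / 2 :: real) ^ n) powr r = 2 powr (- (real n * r))"
          by (simp add: powr_minus_divide powr_divide powr_powr power_one_over flip: powr_realpow)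
        moreover have "\<rho> ^ n = 2 powr (real n) * 2 powr (real n * (2 * real k * \<gamma>)) * 2 powr (- (real n * r))"
          by (simp add: \<rho>_def powr_power flip: powr_add) (simp add: algebra_simps)
        ultimately show ?thesis by (simp add: powr_realpow)
      qed
      finally show "(\<integral>\<^sup>+\<omega>. u n \<omega> \<partial>M) \<le> ennreal (real N * C * \<rho> ^ n)" .
    qed
    then show ?thesis
    proof eventually_elim
      case (elim \<omega>)
      then obtain R where R: "0 \<le> R" "(\<Sum>n. u n \<omega>) = ennreal R"
        by (cases "\<Sum>n. u n \<omega>") auto
      show ?case unfolding Y_def
      proof (rule dyadic_chaining[OF \<gamma>])
        fix n j assume j: "j < N * 2 ^ n"
        define z where "z = \<bar>X (real (Suc j) / 2 ^ n) \<omega> - X (real j / 2 ^ n) \<omega>\<bar> / q ^ n"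
        have z: "0 \<le> z" using q by (simp add: z_def)
        have "ennreal (z ^ (2 * k)) = ennreal (((X (real (Suc j) / 2 ^ n) \<omega> - X (real j / 2 ^ n) \<omega>) / q ^ n) ^ (2 * k))"
          by (simp add: z_def power_divide power_even_abs)
        also have "\<dots> \<le> u n \<omega>"
          unfolding u_def using j by (intro member_le_sum) auto
        also have "\<dots> \<le> ennreal R"
          unfolding R(2)[symmetric] using sum_le_suminf[of "\<lambda>n. u n \<omega>" "{n}"] by simp
        finally have "z ^ (2 * k) \<le> R" using R by simp
        \<comment> \<open>The bound \<open>1 + R\<close> avoids roots: either \<open>z < 1\<close>
          or \<open>z \<le> z ^ (2 * k) \<le> R\<close>.\<close>
        moreover have "z \<le> z ^ (2 * k)" if "1 \<le> z"
          using power_increasing[of 1 "2 * k" z] k that by simp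
        ultimately have "z \<le> 1 + R" using R by (cases "1 \<le> z") auto
        then show "\<bar>X (real (Suc j) / 2 ^ n) \<omega> - X (real j / 2 ^ n) \<omega>\<bar> \<le> (1 + R) * (2 powr - \<gamma>) ^ n"
          using q by (simp add: z_def q_def[symmetric] pos_divide_le_eq)
      qed
    qed
  qed
  then show "AE \<omega> in M. \<forall>N::nat. holder_on {0..real N} (\<lambda>t. Y t \<omega>) \<gamma>"
    by (simp add: AE_all_countable)
qed

section \<open>Spectral representation of the fields\<close>

text \<open>For \<open>u\<close> in \<open>[0, 1]\<close> one has
  \<open>u \<le> u powr \<beta>\<close>; apply this to \<open>s / t\<close> and
  \<open>(t - s) / t\<close>, which sum to 1.\<close>

lemma powr_diff_le:
  fixes \<beta> s t :: real
  assumes "0 < \<beta>" "\<beta> \<le> 1" "0 \<le> s" "0 \<le> t"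
  shows "\<bar>t powr \<beta> - s powr \<beta>\<bar> \<le> \<bar>t - s\<bar> powr \<beta>"
proof -
  have *: "t powr \<beta> - s powr \<beta> \<le> (t - s) powr \<beta>" "s powr \<beta> \<le> t powr \<beta>"
    if st: "0 \<le> s" "s \<le> t" for s t :: real
  proof -
    show "s powr \<beta> \<le> t powr \<beta>" using st assms by (intro powr_mono2) auto
    show "t powr \<beta> - s powr \<beta> \<le> (t - s) powr \<beta>"
    proof (cases "t = 0")
      case False
      with st have t: "0 < t" by simp
      have p: "u \<le> u powr \<beta>" if "0 \<le> u" "u \<le> 1" for u :: real
        using powr_mono'[of \<beta> 1 u] that assms by (cases "u = 0") auto
      have "s / t \<le> (s / t) powr \<beta>" "(t - s) / t \<le> ((t - s) / t) powr \<beta>"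
        using st t by (intro p; simp)+
      then have "s / t + (t - s) / t \<le> s powr \<beta> / t powr \<beta> + (t - s) powr \<beta> / t powr \<beta>"
        using st t by (simp add: powr_divide)
      moreover have "s / t + (t - s) / t = 1" using t by (simp add: field_simps)
      ultimately show ?thesis using t by (simp add: field_simps)
    qed (use st in simp)
  qed
  show ?thesis
  proof (cases "s \<le> t")
    case True
    then show ?thesis using *[of s t] assms by simp
  next
    case False
    then show ?thesis using *[of t s] assms by simp
  qed
qed

text \<open>A real even multiplier commutes with reflection and conjugation, so only integrability
  has to be supplied.\<close>

lemma hermitian_L2_mult_even:
  assumes h: "hermitian_L2 h" and [measurable]: "m \<in> borel_measurable borel"
    and even: "\<And>l. m (- l) = m l"
    and fin: "(\<integral>\<^sup>+l. ennreal ((m l)\<^sup>2 * (cmod (h l))\<^sup>2) \<partial>lborel) < \<infinity>"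
  shows "hermitian_L2 (\<lambda>l. h l * complex_of_real (m l))"
proof -
  have [measurable]: "h \<in> borel_measurable borel" using h by (simp add: hermitian_L2_def)
  have "AE l in lborel. h (- l) = cnj (h l)" using h by (simp add: hermitian_L2_def)
  then have "AE l in lborel. h (- l) * complex_of_real (m (- l)) = cnj (h l * complex_of_real (m l))"
    by eventually_elim (simp add: even)
  then show ?thesis
    using fin by (simp add: hermitian_L2_def norm_mult power_mult_distrib mult.commute)
qed

lemma integrable_hermitian_L2: "hermitian_L2 f \<Longrightarrow> integrable lborel (\<lambda>l. (cmod (f l))\<^sup>2)"
  by (rule integrableI_bounded) (auto simp: hermitian_L2_def)

lemma white_noise_measurable:
  assumes W: "real_white_noise_integral M I" and f: "hermitian_L2 f"
  shows "I f \<in> borel_measurable M"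
proof -
  have "centered_gaussian M (\<lambda>\<omega>. \<Sum>i<length [f]. [1] ! i * I ([f] ! i) \<omega>)
      (LINT l|lborel. (cmod (\<Sum>i<length [f]. complex_of_real ([1] ! i) * ([f] ! i) l))\<^sup>2)"
    using W f unfolding real_white_noise_integral_def by (elim conjE allE[of _ "[f]"] allE[of _ "[1]"]) auto
  then show ?thesis by (simp add: centered_gaussian_def)
qed

text \<open>The law of the difference is read off the combination of \<open>[f, g]\<close> with
  coefficients \<open>[c, - c]\<close>, without invoking pointwise linearity of
  \<open>I\<close>.\<close>

lemma white_noise_diff:
  assumes W: "real_white_noise_integral M I" and f: "hermitian_L2 f" and g: "hermitian_L2 g"
  shows "centered_gaussian M (\<lambda>\<omega>. c * I f \<omega> - c * I g \<omega>) (c\<^sup>2 * (LINT l|lborel. (cmod (f l - g l))\<^sup>2))"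
proof -
  have "centered_gaussian M (\<lambda>\<omega>. \<Sum>i<length [f, g]. [c, - c] ! i * I ([f, g] ! i) \<omega>)
      (LINT l|lborel. (cmod (\<Sum>i<length [f, g]. complex_of_real ([c, - c] ! i) * ([f, g] ! i) l))\<^sup>2)"
    using W f g unfolding real_white_noise_integral_def
    by (elim conjE allE[of _ "[f, g]"] allE[of _ "[c, - c]"]) auto
  moreover have "(\<Sum>i<length [f, g]. complex_of_real ([c, - c] ! i) * ([f, g] ! i) l) = complex_of_real c * (f l - g l)" for l
    by (simp add: algebra_simps)
  ultimately show ?thesis by (simp add: norm_mult power_mult_distrib)
qed

lemma mittag_leffler_even_measurable:
  assumes "0 < \<beta>"
  shows "(\<lambda>l. mittag_leffler \<beta> (- \<mu> * t powr \<beta> * \<bar>l\<bar> powr \<alpha>)) \<in> borel_measurable borel"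
proof -
  have "continuous_on UNIV (mittag_leffler \<beta>)"
    using DERIV_isCont[OF DERIV_mittag_leffler[OF assms]] by (simp add: continuous_on_eq_continuous_at)
  then have [measurable]: "mittag_leffler \<beta> \<in> borel_measurable borel" by (rule borel_measurable_continuous_onI)
  show ?thesis by measurable
qed

lemma hermitian_L2_mittag_leffler:
  assumes h: "hermitian_L2 h" and \<beta>: "0 < \<beta>" "\<beta> \<le> 1" and \<mu>: "0 < \<mu>"
  shows "hermitian_L2 (\<lambda>l. h l * complex_of_real (mittag_leffler \<beta> (- \<mu> * t powr \<beta> * \<bar>l\<bar> powr \<alpha>)))"
proof (rule hermitian_L2_mult_even[OF h mittag_leffler_even_measurable[OF \<beta>(1)]])
  have "(mittag_leffler \<beta> (- \<mu> * t powr \<beta> * \<bar>l\<bar> powr \<alpha>))\<^sup>2 \<le> 1" for l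
    using mittag_leffler_nonneg[OF \<beta>, of "\<mu> * t powr \<beta> * \<bar>l\<bar> powr \<alpha>"]
      mittag_leffler_le_1[OF \<beta>, of "\<mu> * t powr \<beta> * \<bar>l\<bar> powr \<alpha>"] \<mu>
    by (intro power_le_one) auto
  then have "(\<integral>\<^sup>+l. ennreal ((mittag_leffler \<beta> (- \<mu> * t powr \<beta> * \<bar>l\<bar> powr \<alpha>))\<^sup>2 * (cmod (h l))\<^sup>2) \<partial>lborel)
      \<le> (\<integral>\<^sup>+l. ennreal ((cmod (h l))\<^sup>2) \<partial>lborel)"
    by (intro nn_integral_mono ennreal_leI mult_left_le_one_le) auto
  also have "\<dots> < \<infinity>" using h by (simp add: hermitian_L2_def)
  finally show "(\<integral>\<^sup>+l. ennreal ((mittag_leffler \<beta> (- \<mu> * t powr \<beta> * \<bar>l\<bar> powr \<alpha>))\<^sup>2 * (cmod (h l))\<^sup>2) \<partial>lborel) < \<infinity>" .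
qed simp

text \<open>The exponent \<open>\<theta>\<close> is kept separate from \<open>\<eta>\<close> because
  the estimate is global in time: for large \<open>|t - s|\<close> a bound of higher order does not
  imply one of lower order.\<close>

lemma spectral_increment_bound:
  fixes h :: "real \<Rightarrow> complex"
  assumes h: "hermitian_L2 h" and \<alpha>: "0 \<le> \<alpha>" and \<mu>: "0 < \<mu>" and \<beta>: "0 < \<beta>" "\<beta> \<le> 1"
    and \<eta>: "0 < \<eta>" "\<eta> \<le> 1"
    and fin: "(\<integral>\<^sup>+l. ennreal (\<bar>l\<bar> powr (2 * \<alpha> * \<eta>) * (cmod (h l))\<^sup>2) \<partial>lborel) < \<infinity>"
    and \<theta>: "0 < \<theta>" "\<theta> \<le> \<eta>"
  defines "\<Phi> \<equiv> \<lambda>t l. h l * complex_of_real (mittag_leffler \<beta> (- \<mu> * t powr \<beta> * \<bar>l\<bar> powr \<alpha>))"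
  shows "\<exists>C\<ge>0. \<forall>s\<ge>0. \<forall>t\<ge>0. (LINT l|lborel. (cmod (\<Phi> t l - \<Phi> s l))\<^sup>2) \<le> C * \<bar>t - s\<bar> powr (2 * (\<theta> * \<beta>))"
proof -
  have [measurable]: "h \<in> borel_measurable borel" using h by (simp add: hermitian_L2_def)
  define L where "L = inverse (\<beta> * Gamma \<beta>) * \<mu>"
  have L: "0 \<le> L" using \<beta> \<mu> Gamma_real_pos[of \<beta>] by (simp add: L_def)
  define w where "w l = (1 + \<bar>l\<bar> powr (2 * \<alpha> * \<eta>)) * (cmod (h l))\<^sup>2" for l
  have w0: "0 \<le> w l" for l by (simp add: w_def)
  have "integrable lborel (\<lambda>l. \<bar>l\<bar> powr (2 * \<alpha> * \<eta>) * (cmod (h l))\<^sup>2)"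
    by (rule integrableI_bounded) (use fin in auto)
  then have w: "integrable lborel w"
    unfolding w_def distrib_right using integrable_hermitian_L2[OF h] by simp
  define C where "C = L powr (2 * \<theta>) * (LINT l|lborel. w l)"
  show ?thesis
  proof (intro exI conjI allI impI)
    show "0 \<le> C" unfolding C_def using w0 by (intro mult_nonneg_nonneg integral_nonneg_AE) auto
    fix s t :: real assume st: "0 \<le> s" "0 \<le> t"
    have pt: "(cmod (\<Phi> t l - \<Phi> s l))\<^sup>2 \<le> L powr (2 * \<theta>) * \<bar>t - s\<bar> powr (2 * (\<theta> * \<beta>)) * w l" for l
    proof -
      let ?x = "\<mu> * t powr \<beta> * \<bar>l\<bar> powr \<alpha>" and ?y = "\<mu> * s powr \<beta> * \<bar>l\<bar> powr \<alpha>"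
      have "\<bar>mittag_leffler \<beta> (- ?x) - mittag_leffler \<beta> (- ?y)\<bar> \<le> (inverse (\<beta> * Gamma \<beta>) * \<bar>?x - ?y\<bar>) powr \<theta>"
        using \<mu> \<theta> \<eta> by (intro mittag_leffler_Holder \<beta>) auto
      also have "\<bar>?x - ?y\<bar> = \<mu> * \<bar>l\<bar> powr \<alpha> * \<bar>t powr \<beta> - s powr \<beta>\<bar>"
      proof -
        have "?x - ?y = (\<mu> * \<bar>l\<bar> powr \<alpha>) * (t powr \<beta> - s powr \<beta>)" by (simp add: algebra_simps)
        then show ?thesis using \<mu> by (simp only: abs_mult) simp
      qed
      also have "(inverse (\<beta> * Gamma \<beta>) * (\<mu> * \<bar>l\<bar> powr \<alpha> * \<bar>t powr \<beta> - s powr \<beta>\<bar>)) powr \<theta> \<le>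
          (L * \<bar>l\<bar> powr \<alpha> * \<bar>t - s\<bar> powr \<beta>) powr \<theta>"
      proof (rule powr_mono2)
        have "L * \<bar>l\<bar> powr \<alpha> * \<bar>t powr \<beta> - s powr \<beta>\<bar> \<le> L * \<bar>l\<bar> powr \<alpha> * \<bar>t - s\<bar> powr \<beta>"
          using L powr_diff_le[OF \<beta> st] by (intro mult_left_mono) auto
        then show "inverse (\<beta> * Gamma \<beta>) * (\<mu> * \<bar>l\<bar> powr \<alpha> * \<bar>t powr \<beta> - s powr \<beta>\<bar>) \<le> L * \<bar>l\<bar> powr \<alpha> * \<bar>t - s\<bar> powr \<beta>"
          by (simp add: L_def mult.assoc)
      qed (use \<theta> \<beta> \<mu> Gamma_real_pos[of \<beta>] in auto)
      finally have d: "\<bar>mittag_leffler \<beta> (- ?x) - mittag_leffler \<beta> (- ?y)\<bar> \<le> (L * \<bar>l\<bar> powr \<alpha> * \<bar>t - s\<bar> powr \<beta>) powr \<theta>" .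
      have "\<Phi> t l - \<Phi> s l = h l * complex_of_real (mittag_leffler \<beta> (- ?x) - mittag_leffler \<beta> (- ?y))"
        by (simp add: \<Phi>_def algebra_simps)
      then have "(cmod (\<Phi> t l - \<Phi> s l))\<^sup>2 = \<bar>mittag_leffler \<beta> (- ?x) - mittag_leffler \<beta> (- ?y)\<bar>\<^sup>2 * (cmod (h l))\<^sup>2"
        by (simp only: norm_mult norm_of_real power_mult_distrib mult.commute)
      also have "\<dots> \<le> ((L * \<bar>l\<bar> powr \<alpha> * \<bar>t - s\<bar> powr \<beta>) powr \<theta>)\<^sup>2 * (cmod (h l))\<^sup>2"
        by (intro mult_right_mono power_mono d) auto
      also have "((L * \<bar>l\<bar> powr \<alpha> * \<bar>t - s\<bar> powr \<beta>) powr \<theta>)\<^sup>2 =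
          L powr (2 * \<theta>) * \<bar>t - s\<bar> powr (2 * (\<theta> * \<beta>)) * \<bar>l\<bar> powr (2 * \<alpha> * \<theta>)"
        using L by (simp add: powr_mult powr_powr power_mult_distrib power2_eq_square mult_ac flip: powr_add)
      also have "\<dots> \<le> L powr (2 * \<theta>) * \<bar>t - s\<bar> powr (2 * (\<theta> * \<beta>)) * (1 + \<bar>l\<bar> powr (2 * \<alpha> * \<eta>))"
      proof (intro mult_left_mono)
        \<comment> \<open>Low frequencies are paid for by square integrability of \<open>h\<close>,
          high ones by the weight of order \<open>\<eta>\<close>.\<close>
        show "\<bar>l\<bar> powr (2 * \<alpha> * \<theta>) \<le> 1 + \<bar>l\<bar> powr (2 * \<alpha> * \<eta>)"
        proof (cases "\<bar>l\<bar> \<le> 1")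
          case True
          then have "\<bar>l\<bar> powr (2 * \<alpha> * \<theta>) \<le> 1" using \<alpha> \<theta> by (intro powr_le1) auto
          then show ?thesis by (simp add: add_increasing2)
        next
          case False
          then have "\<bar>l\<bar> powr (2 * \<alpha> * \<theta>) \<le> \<bar>l\<bar> powr (2 * \<alpha> * \<eta>)"
            using \<alpha> \<theta> by (intro powr_mono mult_left_mono) auto
          then show ?thesis by simp
        qed
      qed auto
      finally show ?thesis by (simp add: w_def mult.assoc mult_right_mono)
    qed
    have "(LINT l|lborel. (cmod (\<Phi> t l - \<Phi> s l))\<^sup>2) \<le>
        (LINT l|lborel. L powr (2 * \<theta>) * \<bar>t - s\<bar> powr (2 * (\<theta> * \<beta>)) * w l)"
    proof (rule integral_mono_AE)
      show "integrable lborel (\<lambda>l. L powr (2 * \<theta>) * \<bar>t - s\<bar> powr (2 * (\<theta> * \<beta>)) * w l)"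
        using w by simp
      have [measurable]: "\<Phi> t \<in> borel_measurable borel" "\<Phi> s \<in> borel_measurable borel"
        using hermitian_L2_mittag_leffler[OF h \<beta> \<mu>] by (simp_all add: hermitian_L2_def \<Phi>_def)
      show "integrable lborel (\<lambda>l. (cmod (\<Phi> t l - \<Phi> s l))\<^sup>2)"
        by (rule Bochner_Integration.integrable_bound[where f = "\<lambda>l. L powr (2 * \<theta>) * \<bar>t - s\<bar> powr (2 * (\<theta> * \<beta>)) * w l"])
          (use w pt in \<open>auto intro: order_trans[OF _ abs_ge_self]\<close>)
    qed (use pt in simp)
    then show "(LINT l|lborel. (cmod (\<Phi> t l - \<Phi> s l))\<^sup>2) \<le> C * \<bar>t - s\<bar> powr (2 * (\<theta> * \<beta>))"
      by (simp add: C_def mult_ac)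
  qed
qed

section \<open>Assembly of the regularity statements\<close>

lemma holder_modificationI:
  assumes "\<And>t. Y t \<in> borel_measurable M" "\<And>t. 0 \<le> t \<Longrightarrow> AE \<omega> in M. Y t \<omega> = X t \<omega>"
    and Y: "AE \<omega> in M. \<forall>N::nat. holder_on {0..real N} (\<lambda>t. Y t \<omega>) \<gamma>" and \<gamma>: "0 < \<gamma>"
  shows "holder_modification M X \<gamma>"
  unfolding holder_modification_def
proof (intro exI[of _ Y] conjI allI impI)
  show "AE \<omega> in M. continuous_on {0<..} (\<lambda>t. Y t \<omega>) \<and> (\<forall>a b. 0 < a \<longrightarrow> holder_on {a..b} (\<lambda>t. Y t \<omega>) \<gamma>)"
    using Y
  proof eventually_elim
    case (elim \<omega>)
    show ?case
    proof (intro conjI allI impI)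
      fix a b :: real assume "0 < a"
      obtain N :: nat where "b \<le> real N" using real_arch_simple by blast
      with \<open>0 < a\<close> have "{a..b} \<subseteq> {0..real N}" by auto
      moreover have "holder_on {0..real N} (\<lambda>t. Y t \<omega>) \<gamma>" using elim by blast
      ultimately show "holder_on {a..b} (\<lambda>t. Y t \<omega>) \<gamma>" unfolding holder_on_def by (meson subsetD)
    next
      have "isCont (\<lambda>t. Y t \<omega>) t" if t: "0 < t" for t
      proof -
        \<comment> \<open>Strict inequality makes \<open>(0, N)\<close> a neighbourhood of
          \<open>t\<close>, on which the Hoelder bound forces continuity.\<close>
        obtain N :: nat where N: "t < real N" using reals_Archimedean2 by blast
        obtain C where C: "\<And>s. s \<in> {0..real N} \<Longrightarrow> \<bar>Y s \<omega> - Y t \<omega>\<bar> \<le> C * \<bar>s - t\<bar> powr \<gamma>"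
          using elim t N unfolding holder_on_def by (metis atLeastAtMost_iff less_imp_le)
        have "((\<lambda>s. C * \<bar>s - t\<bar> powr \<gamma>) \<longlongrightarrow> C * \<bar>t - t\<bar> powr \<gamma>) (at t)"
          using \<gamma> by (intro tendsto_intros tendsto_powr') auto
        then have "((\<lambda>s. C * \<bar>s - t\<bar> powr \<gamma>) \<longlongrightarrow> 0) (at t)" by simp
        moreover have "eventually (\<lambda>s. norm (Y s \<omega> - Y t \<omega>) \<le> C * \<bar>s - t\<bar> powr \<gamma>) (at t)"
        proof -
          have "eventually (\<lambda>s. s \<in> {0<..<real N}) (at t)"
            using t N by (intro eventually_at_in_open') auto
          then show ?thesis by eventually_elim (use C in auto)
        qed
        ultimately have "((\<lambda>s. Y s \<omega> - Y t \<omega>) \<longlongrightarrow> 0) (at t)" by (rule Lim_null_comparison[rotated])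
        then show ?thesis by (simp add: isCont_def LIM_zero_iff)
      qed
      then show "continuous_on {0<..} (\<lambda>t. Y t \<omega>)"
        by (intro continuous_at_imp_continuous_on) auto
    qed
  qed
qed (use assms in auto)

text \<open>Common form of both fields: \<open>h\<close> is the transform itself or the transform
  times the singular factor \<open>|l| powr ((\<kappa> 0 - 1) / 2)\<close>, and \<open>c\<close> is
  the square root of the constant in front.\<close>

lemma spectral_field_holder:
  fixes h :: "real \<Rightarrow> complex" and I :: "(real \<Rightarrow> complex) \<Rightarrow> 'a \<Rightarrow> real" and c :: real
  assumes W: "real_white_noise_integral M I" and h: "hermitian_L2 h"
    and \<alpha>: "0 \<le> \<alpha>" and \<mu>: "0 < \<mu>" and \<beta>: "0 < \<beta>" "\<beta> \<le> 1" and \<eta>: "0 < \<eta>" "\<eta> \<le> 1"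
    and fin: "(\<integral>\<^sup>+l. ennreal (\<bar>l\<bar> powr (2 * \<alpha> * \<eta>) * (cmod (h l))\<^sup>2) \<partial>lborel) < \<infinity>"
    and \<gamma>: "0 < \<gamma>" "\<gamma> < \<eta> * \<beta>"
  defines "X \<equiv> \<lambda>t \<omega>. c * I (\<lambda>l. h l * complex_of_real (mittag_leffler \<beta> (- \<mu> * t powr \<beta> * \<bar>l\<bar> powr \<alpha>))) \<omega>"
  shows "ms_holder M X \<gamma>" "holder_modification M X \<gamma>"
proof -
  have M: "prob_space M" using W by (simp add: real_white_noise_integral_def)
  define \<Phi> where "\<Phi> = (\<lambda>t l. h l * complex_of_real (mittag_leffler \<beta> (- \<mu> * t powr \<beta> * \<bar>l\<bar> powr \<alpha>)))"
  have \<Phi>: "hermitian_L2 (\<Phi> t)" for t unfolding \<Phi>_def by (rule hermitian_L2_mittag_leffler[OF h \<beta> \<mu>])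
  have X: "X t = (\<lambda>\<omega>. c * I (\<Phi> t) \<omega>)" for t by (simp add: X_def \<Phi>_def)
  have Xm: "X t \<in> borel_measurable M" for t
    unfolding X using white_noise_measurable[OF W \<Phi>] by measurable
  define v where "v s t = c\<^sup>2 * (LINT l|lborel. (cmod (\<Phi> t l - \<Phi> s l))\<^sup>2)" for s t
  have v0: "0 \<le> v s t" for s t by (simp add: v_def)
  have moment: "(\<integral>\<^sup>+\<omega>. ennreal ((X t \<omega> - X s \<omega>) ^ (2 * k)) \<partial>M) = ennreal (fact (2 * k) / (2 ^ k * fact k) * v s t ^ k)" for s t k
    unfolding X v_def by (rule centered_gaussian_even_moment[OF M white_noise_diff[OF W \<Phi> \<Phi>]]) simp
  \<comment> \<open>Time 0 is included because the dyadic grid of the criterion starts there;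
    \<open>0 powr \<beta> = 0\<close> gives the multiplier the value 1.\<close>
  have bound: "\<exists>C\<ge>0. \<forall>s\<ge>0. \<forall>t\<ge>0. v s t \<le> C * \<bar>t - s\<bar> powr (2 * (\<theta> * \<beta>))" if \<theta>: "0 < \<theta>" "\<theta> \<le> \<eta>" for \<theta>
  proof -
    have "\<exists>C\<ge>0. \<forall>s\<ge>0. \<forall>t\<ge>0. (LINT l|lborel. (cmod (\<Phi> t l - \<Phi> s l))\<^sup>2) \<le> C * \<bar>t - s\<bar> powr (2 * (\<theta> * \<beta>))"
      unfolding \<Phi>_def by (rule spectral_increment_bound[OF h \<alpha> \<mu> \<beta> \<eta> fin \<theta>])
    then obtain C where C: "0 \<le> C"
        "\<forall>s\<ge>0. \<forall>t\<ge>0. (LINT l|lborel. (cmod (\<Phi> t l - \<Phi> s l))\<^sup>2) \<le> C * \<bar>t - s\<bar> powr (2 * (\<theta> * \<beta>))"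
      by (elim exE conjE)
    have "v s t \<le> (c\<^sup>2 * C) * \<bar>t - s\<bar> powr (2 * (\<theta> * \<beta>))" if "0 \<le> s" "0 \<le> t" for s t
      using mult_left_mono[OF C(2)[rule_format, OF that], of "c\<^sup>2"] by (simp add: v_def mult.assoc)
    then show ?thesis using C(1) by (intro exI[of _ "c\<^sup>2 * C"]) simp
  qed
  show "ms_holder M X \<gamma>"
  proof -
    \<comment> \<open>For the mean-square statement, \<open>\<theta> = \<gamma> / \<beta>\<close>
      yields exactly the order \<open>\<gamma>\<close> at all distances.\<close>
    have \<theta>: "0 < \<gamma> / \<beta>" "\<gamma> / \<beta> \<le> \<eta>" "\<gamma> / \<beta> * \<beta> = \<gamma>" using \<gamma> \<beta> by (auto simp: field_simps)
    obtain C where C: "\<And>s t. 0 \<le> s \<Longrightarrow> 0 \<le> t \<Longrightarrow> v s t \<le> C * \<bar>t - s\<bar> powr (2 * \<gamma>)"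
      using bound[OF \<theta>(1,2)] unfolding \<theta>(3) by blast
    show ?thesis unfolding ms_holder_def
    proof (intro exI allI impI)
      fix t s :: real assume "0 < t" "0 < s"
      then have "ennreal (v s t) \<le> ennreal (C * \<bar>t - s\<bar> powr (2 * \<gamma>))" by (intro ennreal_leI C) auto
      then show "(\<integral>\<^sup>+\<omega>. ennreal ((X t \<omega> - X s \<omega>)\<^sup>2) \<partial>M) \<le> ennreal (C * \<bar>t - s\<bar> powr (2 * \<gamma>))"
        using moment[of t s 1] by simp
    qed
  qed
  \<comment> \<open>For the paths the largest exponent \<open>\<theta> = \<eta>\<close> is taken,
    leaving room between \<open>\<gamma>\<close> and \<open>\<eta> * \<beta>\<close>.\<close>
  obtain C where C: "0 \<le> C" "\<And>s t. 0 \<le> s \<Longrightarrow> 0 \<le> t \<Longrightarrow> v s t \<le> C * \<bar>t - s\<bar> powr (2 * (\<eta> * \<beta>))"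
    using bound[OF \<eta>(1) order_refl] by blast
  \<comment> \<open>A high moment makes \<open>2 * k * (\<eta> * \<beta> - \<gamma>) > 1\<close>,
    the exponent condition of the criterion.\<close>
  obtain k :: nat where k: "1 / (2 * (\<eta> * \<beta> - \<gamma>)) < real k" using reals_Archimedean2 by blast
  then have k0: "0 < k" using \<gamma> by (intro Nat.gr0I) (auto simp: field_simps)
  have r: "1 + 2 * real k * \<gamma> < 2 * real k * (\<eta> * \<beta>)"
    using k \<gamma> by (simp add: field_simps)
  define D where "D = fact (2 * k) / (2 ^ k * fact k) * C ^ k"
  have D: "0 \<le> D" using C by (simp add: D_def)
  have "(\<integral>\<^sup>+\<omega>. ennreal ((X t \<omega> - X s \<omega>) ^ (2 * k)) \<partial>M) \<le> ennreal (D * \<bar>t - s\<bar> powr (2 * real k * (\<eta> * \<beta>)))"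
    if "0 \<le> s" "0 \<le> t" for s t
  proof -
    have "v s t ^ k \<le> (C * \<bar>t - s\<bar> powr (2 * (\<eta> * \<beta>))) ^ k"
      using C(2)[OF that] v0 by (intro power_mono)
    also have "\<dots> = C ^ k * \<bar>t - s\<bar> powr (2 * real k * (\<eta> * \<beta>))"
    proof -
      have "(\<bar>t - s\<bar> powr (2 * (\<eta> * \<beta>))) ^ k = \<bar>t - s\<bar> powr (real k * (2 * (\<eta> * \<beta>)))"
        \<comment> \<open>For \<open>t = s\<close> both sides are 0, the left one because
          \<open>k\<close> is positive.\<close>
        using k0 by (cases "t = s") (simp_all add: powr_power mult.commute)
      then show ?thesis by (simp add: power_mult_distrib mult_ac)
    qed
    finally have "fact (2 * k) / (2 ^ k * fact k) * v s t ^ k \<le> fact (2 * k) / (2 ^ k * fact k) * (C ^ k * \<bar>t - s\<bar> powr (2 * real k * (\<eta> * \<beta>)))"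
      by (intro mult_left_mono) auto
    then show ?thesis unfolding moment D_def by (intro ennreal_leI) (simp only: mult.assoc)
  qed
  note KC = Kolmogorov_Chentsov[of X M k D, OF Xm this k0 D \<gamma>(1) r]
  show "holder_modification M X \<gamma>" by (rule holder_modificationI[OF KC \<gamma>(1)])
qed

theorem theorem4p1:
  fixes \<alpha> \<mu> \<beta> :: real
    and g :: "real \<Rightarrow> real \<Rightarrow> real"
    and ghat :: "real \<Rightarrow> real \<Rightarrow> complex"
    and n :: nat and A \<kappa> w :: "nat \<Rightarrow> real"
    and M :: "'a measure" and I :: "(real \<Rightarrow> complex) \<Rightarrow> 'a \<Rightarrow> real"
  assumes "\<alpha> \<ge> 0" and "\<mu> > 0" and "0 < \<beta>" and "\<beta> \<le> 1"
    and g_L2: "\<forall>x. (\<lambda>y. g y x) \<in> borel_measurable lborel \<and> integrable lborel (\<lambda>y. (g y x)\<^sup>2)"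
    and ghat: "\<forall>x. l2_fourier_transform (\<lambda>y. g y x) (\<lambda>l. ghat l x)"
    and A_nonneg: "\<forall>j\<le>n. 0 \<le> A j" and A_sum: "(\<Sum>j\<le>n. A j) = 1"
    and kappa: "\<forall>j\<le>n. 0 < \<kappa> j \<and> \<kappa> j < 1"
    and w_pos: "\<forall>j\<in>{1..n}. 0 < w j"
    and W: "real_white_noise_integral M I"
  shows
    "(eta_set \<alpha> 0 ghat \<noteq> {} \<longrightarrow>
        (\<forall>\<gamma>. 0 < \<gamma> \<and> \<gamma> < Sup (eta_set \<alpha> 0 ghat) * \<beta> \<longrightarrow>
          (\<forall>x. ms_holder M (\<lambda>t. U0 I (C_bar n \<kappa> w A) \<alpha> \<beta> \<mu> ghat t x) \<gamma> \<and>
               holder_modification M (\<lambda>t. U0 I (C_bar n \<kappa> w A) \<alpha> \<beta> \<mu> ghat t x) \<gamma>)))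
   \<and> (eta_set \<alpha> (\<kappa> 0 - 1) ghat \<noteq> {} \<and>
       (\<forall>x. (\<integral>\<^sup>+ l. ennreal (\<bar>l\<bar> powr (\<kappa> 0 - 1) * (cmod (ghat l x))\<^sup>2) \<partial>lborel) < \<infinity>) \<longrightarrow>
        (\<forall>\<gamma>. 0 < \<gamma> \<and> \<gamma> < Sup (eta_set \<alpha> (\<kappa> 0 - 1) ghat) * \<beta> \<longrightarrow>
          (\<forall>x. ms_holder M (\<lambda>t. U0_tilde I (C_zero (\<kappa> 0) (A 0)) (\<kappa> 0) \<alpha> \<beta> \<mu> ghat t x) \<gamma> \<and>
               holder_modification M (\<lambda>t. U0_tilde I (C_zero (\<kappa> 0) (A 0)) (\<kappa> 0) \<alpha> \<beta> \<mu> ghat t x) \<gamma>)))"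
proof -
  have H: "hermitian_L2 (\<lambda>l. ghat l x)" for x
    using g_L2 ghat by (intro l2_fourier_transform_hermitian_L2) auto
  \<comment> \<open>Below the supremum some admissible \<open>\<eta>\<close> still exceeds
    \<open>\<gamma> / \<beta>\<close>, whether or not the supremum is attained.\<close>
  have \<eta>: "\<exists>\<eta>. 0 < \<eta> \<and> \<eta> \<le> 1 \<and> \<gamma> < \<eta> * \<beta> \<and>
      (\<forall>x. (\<integral>\<^sup>+ l. ennreal (\<bar>l\<bar> powr (2 * \<alpha> * \<eta> + e) * (cmod (ghat l x))\<^sup>2) \<partial>lborel) < \<infinity>)"
    if "eta_set \<alpha> e ghat \<noteq> {}" "\<gamma> < Sup (eta_set \<alpha> e ghat) * \<beta>" for \<gamma> e
  proof -
    have "\<gamma> / \<beta> < Sup (eta_set \<alpha> e ghat)" using that \<open>0 < \<beta>\<close> by (simp add: field_simps)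
    from this that(1) obtain \<eta> where "\<eta> \<in> eta_set \<alpha> e ghat" "\<gamma> / \<beta> < \<eta>"
      by (rule less_cSupE)
    then show ?thesis using \<open>0 < \<beta>\<close> by (auto simp: eta_set_def field_simps)
  qed
  note field = spectral_field_holder[OF W _ \<open>\<alpha> \<ge> 0\<close> \<open>\<mu> > 0\<close> \<open>0 < \<beta>\<close> \<open>\<beta> \<le> 1\<close>]
  define h where "h x l = ghat l x * complex_of_real (\<bar>l\<bar> powr ((\<kappa> 0 - 1) / 2))" for x l
  have tilde: "U0_tilde I c (\<kappa> 0) \<alpha> \<beta> \<mu> ghat t x = (\<lambda>\<omega>. sqrt c *
      I (\<lambda>l. h x l * complex_of_real (mittag_leffler \<beta> (- \<mu> * t powr \<beta> * \<bar>l\<bar> powr \<alpha>))) \<omega>)" for c t x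
    by (simp add: U0_tilde_def h_def fun_eq_iff mult_ac)
  have sq: "(\<bar>l\<bar> powr ((\<kappa> 0 - 1) / 2))\<^sup>2 = \<bar>l\<bar> powr (\<kappa> 0 - 1)" for l :: real
    by (simp add: power2_eq_square flip: powr_add)
  have fin_eq: "\<bar>l\<bar> powr (2 * \<alpha> * \<eta> + (\<kappa> 0 - 1)) * (cmod (ghat l x))\<^sup>2 = \<bar>l\<bar> powr (2 * \<alpha> * \<eta>) * (cmod (h x l))\<^sup>2" for \<eta> l x
    by (simp add: h_def norm_mult power_mult_distrib sq powr_add)
  \<comment> \<open>Admissibility of the integrand needs its own integral condition: near
    \<open>l = 0\<close> the weight \<open>|l| powr (\<kappa> 0 - 1)\<close> is not controlled by
    \<open>|l| powr (2 * \<alpha> * \<eta> + (\<kappa> 0 - 1))\<close> when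
    \<open>\<alpha> > 0\<close>.\<close>
  have H': "hermitian_L2 (h x)"
    if "\<forall>x. (\<integral>\<^sup>+ l. ennreal (\<bar>l\<bar> powr (\<kappa> 0 - 1) * (cmod (ghat l x))\<^sup>2) \<partial>lborel) < \<infinity>" for x
    unfolding h_def by (rule hermitian_L2_mult_even[OF H]) (use that in \<open>auto simp: sq\<close>)
  have 1: "ms_holder M (\<lambda>t. U0 I (C_bar n \<kappa> w A) \<alpha> \<beta> \<mu> ghat t x) \<gamma> \<and>
      holder_modification M (\<lambda>t. U0 I (C_bar n \<kappa> w A) \<alpha> \<beta> \<mu> ghat t x) \<gamma>"
    if asm: "eta_set \<alpha> 0 ghat \<noteq> {}" "0 < \<gamma>" "\<gamma> < Sup (eta_set \<alpha> 0 ghat) * \<beta>" for \<gamma> x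
  proof -
    obtain \<eta> where e: "0 < \<eta>" "\<eta> \<le> 1" "\<gamma> < \<eta> * \<beta>"
      "(\<integral>\<^sup>+ l. ennreal (\<bar>l\<bar> powr (2 * \<alpha> * \<eta> + 0) * (cmod (ghat l x))\<^sup>2) \<partial>lborel) < \<infinity>"
      using \<eta>[OF asm(1,3)] by blast
    note * = H e(1,2) e(4)[unfolded add_0_right] asm(2) e(3)
    show ?thesis unfolding U0_def by (rule conjI field[OF *])+
  qed
  have 2: "ms_holder M (\<lambda>t. U0_tilde I (C_zero (\<kappa> 0) (A 0)) (\<kappa> 0) \<alpha> \<beta> \<mu> ghat t x) \<gamma> \<and>
      holder_modification M (\<lambda>t. U0_tilde I (C_zero (\<kappa> 0) (A 0)) (\<kappa> 0) \<alpha> \<beta> \<mu> ghat t x) \<gamma>"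
    if asm: "eta_set \<alpha> (\<kappa> 0 - 1) ghat \<noteq> {}"
      "\<forall>x. (\<integral>\<^sup>+ l. ennreal (\<bar>l\<bar> powr (\<kappa> 0 - 1) * (cmod (ghat l x))\<^sup>2) \<partial>lborel) < \<infinity>"
      "0 < \<gamma>" "\<gamma> < Sup (eta_set \<alpha> (\<kappa> 0 - 1) ghat) * \<beta>" for \<gamma> x
  proof -
    obtain \<eta> where e: "0 < \<eta>" "\<eta> \<le> 1" "\<gamma> < \<eta> * \<beta>"
      "(\<integral>\<^sup>+ l. ennreal (\<bar>l\<bar> powr (2 * \<alpha> * \<eta> + (\<kappa> 0 - 1)) * (cmod (ghat l x))\<^sup>2) \<partial>lborel) < \<infinity>"
      using \<eta>[OF asm(1,4)] by blast
    note * = H'[OF asm(2)] e(1,2) e(4)[unfolded fin_eq] asm(3) e(3)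
    show ?thesis unfolding tilde by (rule conjI field[OF *])+
  qed
  show ?thesis using 1 2 by blast
qed

end
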